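(* Let $\mathcal{G}$ be a locally compact group with Haar measure $dz$, $\pi$ a representation of $\mathcal{G}$ on a Hilbert space $\mathcal{H}$, $\nu$ a continuous submultiplicative weight function on $\mathcal{G}$, and $(Y,\|\cdot\|_Y)$ a Banach space of functions on $\mathcal{G}$, such that conditions (A), (B), (C) listed in the context hold. Assume in addition that $Y$ has an absolutely continuous norm. Let $g\in\mathcal{A}_\nu\setminus\{0\}$. For a closed and bounded set $S\subseteq\mathcal{C}o_\pi Y$ the following statements are equivalent: (i) $S$ is compact in $\mathcal{C}o_\pi Y$. (ii) For every $\epsilon>0$ there exists a compact set $U\subseteq\mathcal{G}$ such that $$\sup_{f\in S}\|\chi_{U^c}\,\mathcal{V}_g f\|_Y<\epsilon .$$
   Context: The weight $\nu$ satisfies $\nu(z_1z_2)\le\nu(z_1)\nu(z_2)$ and $\nu(z_1)\ge1$ for all $z_1,z_2\in\mathcal{G}$, and $L^1_\nu(\mathcal{G})$ has norm $\|F\|_{L^1_\nu}=\int_{\mathcal{G}}|F(z)|\nu(z)\,dz$. For $f,g\in\mathcal{H}$ the representation coefficient is $\mathcal{V}_g f(z)=\langle f,\pi(z)g\rangle$, $z\in\mathcal{G}$. Standing assumptions: (A) $\pi$ is irreducible, unitary, continuous and $\nu$-integrable, i.e., there exists $g\in\mathcal{H}$, $g\ne0$, such that $\int_{\mathcal{G}}|\langle\pi(z)g,g\rangle|\,\nu(z)\,dz<\infty$. (B) $Y$ is a solid Banach function space on $\mathcal{G}$: if $F\in Y$ and $G$ is measurable with $|G(z)|\le|F(z)|$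 for almost all $z\in\mathcal{G}$, then $G\in Y$ and $\|G\|_Y\le\|F\|_Y$. (C) $Y$ is invariant under right and left translations and $Y*L^1_\nu(\mathcal{G})\subseteq Y$ with $\|F*G\|_Y\le\|F\|_Y\|G\|_{L^1_\nu(\mathcal{G})}$ for $F\in Y$, $G\in L^1_\nu(\mathcal{G})$. (The paper notes that under these conditions $Y$ contains the space $L^\infty_0(\mathcal{G})$ of bounded functions with compact support.) Absolutely continuous norm: $Y$ has absolutely continuous norm if $\|f\chi_{E_n}\|_Y\to0$ for every $f\in Y$ and every sequence $(E_n)_{n\ge1}$ of measurable subsets of $\mathcal{G}$ with $E_n\to\emptyset$ almost everywhere with respect to Haar measure (i.e. $\chi_{E_n}\to0$ a.e.). Test functions and distributions: fix $g_0\in\mathcal{H}\setminus\{0\}$ with $\int_{\mathcal{G}}|\langle\pi(z)g_0,g_0\rangle|\nu(z)\,dz<\infty$. Then $\mathcal{A}_\nu=\{g\in\mathcal{H}:\|g\|_{\mathcal{A}_\nu}=\|\mathcal{V}_{g_0}g\|_{L^1_\nu(\mathcal{G})}<\infty\}$. This space is $\pi$-invariant and dense in $\mathcal{H}$. $\mathcal{A}_\nu'$ is the space of all continuous conjugate-linear functionals on $\mathcal{A}_\nu$; it contains $\mathcal{H}$, and for $f\in\mathcal{A}_\nu'$, $g\in\mathcal{A}_\nu$ one sets $\mathcal{V}_gf(z)=\langle f,\pi(z)g\rangle$ using the duality pairing that extends the inner product of $\mathcal{H}$. Coorbit space: for $g\in\mathcal{A}_\nu\setminus\{0\}$, $\mathcal{C}o_\pi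 Y=\{f\in\mathcal{A}_\nu':\mathcal{V}_gf\in Y\}$ with norm $\|f\|_{\mathcal{C}o_\pi Y}=\|\mathcal{V}_gf\|_Y$. Known facts from coorbit theory recalled by the paper: $\mathcal{C}o_\pi Y$ is a Banach space, it does not depend on the choice of $g\in\mathcal{A}_\nu\setminus\{0\}$ (different $g$ give equivalent norms), $\|\pi(z)f\|_{\mathcal{C}o_\pi Y}\le C\nu(z)\|f\|_{\mathcal{C}o_\pi Y}$, and $\|f\|_{\mathcal{A}_\nu'}\le C\|f\|_{\mathcal{C}o_\pi Y}$. $\chi_{U^c}$ is the indicator function of the complement of $U$ in $\mathcal{G}$. *)

theory Defs
  imports "HOL-Analysis.Analysis"
begin

section \<open>Complex Hilbert spaces\<close>

text \<open>The inner product is linear in its first argument.\<close>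

class complex_hilbert_space = banach +
  fixes scaleC :: "complex \<Rightarrow> 'a \<Rightarrow> 'a" (infixr "*\<^sub>C" 75)
    and cinner :: "'a \<Rightarrow> 'a \<Rightarrow> complex"
  assumes scaleC_add_right: "a *\<^sub>C (x + y) = a *\<^sub>C x + a *\<^sub>C y"
    and scaleC_add_left: "(a + b) *\<^sub>C x = a *\<^sub>C x + b *\<^sub>C x"
    and scaleC_scaleC: "a *\<^sub>C (b *\<^sub>C x) = (a * b) *\<^sub>C x"
    and scaleC_of_real: "complex_of_real r *\<^sub>C x = r *\<^sub>R x"
    and cinner_commute: "cinner x y = cnj (cinner y x)"
    and cinner_add_left: "cinner (x + y) z = cinner x z + cinner y z"
    and cinner_scaleC_left: "cinner (a *\<^sub>C x) y = a * cinner x y"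
    and norm_eq_sqrt_cinner: "norm x = sqrt (Re (cinner x x))"

instantiation complex :: complex_hilbert_space
begin

definition scaleC_complex :: "complex \<Rightarrow> complex \<Rightarrow> complex" where
  "scaleC_complex a x = a * x"

definition cinner_complex :: "complex \<Rightarrow> complex \<Rightarrow> complex" where
  "cinner_complex x y = x * cnj y"

instance
  by standard
    (auto simp: scaleC_complex_def cinner_complex_def algebra_simps scaleR_conv_of_real
      cmod_def power2_eq_square)

end

section \<open>Haar measure and weights\<close>

text \<open>
  Groups are types of class \<^class>\<open>topological_group_add\<close>; the operation is written
  additively but is not assumed to be commutative.  No countability assumption is made on the
  group, so regularity is required in the form valid for arbitrary locally compact groups.
\<close>

definition left_haar_measure :: "'g::{topological_group_add,t2_space} measure \<Rightarrow> bool" where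
  "left_haar_measure M \<longleftrightarrow>
     sets M = sets borel \<and>
     emeasure M UNIV \<noteq> 0 \<and>
     (\<forall>a. \<forall>A\<in>sets borel. emeasure M ((\<lambda>x. a + x) ` A) = emeasure M A) \<and>
     (\<forall>K. compact K \<longrightarrow> emeasure M K < \<infinity>) \<and>
     (\<forall>A\<in>sets borel. emeasure M A = (INF U\<in>{U. open U \<and> A \<subseteq> U}. emeasure M U)) \<and>
     (\<forall>U. open U \<longrightarrow> emeasure M U = (SUP K\<in>{K. compact K \<and> K \<subseteq> U}. emeasure M K))"

definition submultiplicative_weight :: "('g::topological_group_add \<Rightarrow> real) \<Rightarrow> bool" where
  "submultiplicative_weight \<nu> \<longleftrightarrow>
     continuous_on UNIV \<nu> \<and> (\<forall>x y. \<nu> (x + y) \<le> \<nu> x * \<nu> y) \<and> (\<forall>x. 1 \<le> \<nu> x)"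

definition weighted_L1 :: "'g measure \<Rightarrow> ('g \<Rightarrow> real) \<Rightarrow> ('g \<Rightarrow> complex) set" where
  "weighted_L1 M \<nu> = {F \<in> borel_measurable M. integrable M (\<lambda>z. cmod (F z) * \<nu> z)}"

definition weighted_L1_norm :: "'g measure \<Rightarrow> ('g \<Rightarrow> real) \<Rightarrow> ('g \<Rightarrow> complex) \<Rightarrow> real" where
  "weighted_L1_norm M \<nu> F = (\<integral>z. cmod (F z) * \<nu> z \<partial>M)"

text \<open>\<open>(F * G)(x) = \<integral> F(y) G(y\<inverse> x) dy\<close>\<close>

definition group_convolution ::
    "'g::topological_group_add measure \<Rightarrow> ('g \<Rightarrow> complex) \<Rightarrow> ('g \<Rightarrow> complex) \<Rightarrow> 'g \<Rightarrow> complex" where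
  "group_convolution M F G x = (\<integral>y. F y * G (- y + x) \<partial>M)"

section \<open>Banach function spaces on the group\<close>

text \<open>
  A space of functions modulo equality almost everywhere is given by the set \<open>Y\<close> of all
  representatives of its elements, with a norm on representatives that vanishes exactly on the
  null functions.  For a solid space, \<open>Y\<close> is closed under changes on null sets.
\<close>

definition banach_function_space ::
    "'g measure \<Rightarrow> ('g \<Rightarrow> complex) set \<Rightarrow> (('g \<Rightarrow> complex) \<Rightarrow> real) \<Rightarrow> bool" where
  "banach_function_space M Y nY \<longleftrightarrow>
     Y \<subseteq> borel_measurable M \<and>
     (\<lambda>x. 0) \<in> Y \<and>
     (\<forall>F\<in>Y. \<forall>G\<in>Y. (\<lambda>x. F x + G x) \<in> Y \<and> nY (\<lambda>x. F x + G x) \<le> nY F + nY G) \<and>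
     (\<forall>F\<in>Y. \<forall>c. (\<lambda>x. c * F x) \<in> Y \<and> nY (\<lambda>x. c * F x) = cmod c * nY F) \<and>
     (\<forall>F\<in>Y. 0 \<le> nY F \<and> (nY F = 0 \<longleftrightarrow> (AE x in M. F x = 0))) \<and>
     (\<forall>F :: nat \<Rightarrow> 'g \<Rightarrow> complex.
        (\<forall>n. F n \<in> Y) \<and>
        (\<forall>e>0. \<exists>N. \<forall>m\<ge>N. \<forall>n\<ge>N. nY (\<lambda>x. F m x - F n x) < e) \<longrightarrow>
        (\<exists>G\<in>Y. (\<lambda>n. nY (\<lambda>x. F n x - G x)) \<longlonglongrightarrow> 0))"

definition solid ::
    "'g measure \<Rightarrow> ('g \<Rightarrow> complex) set \<Rightarrow> (('g \<Rightarrow> complex) \<Rightarrow> real) \<Rightarrow> bool" where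
  "solid M Y nY \<longleftrightarrow>
     (\<forall>F\<in>Y. \<forall>G\<in>borel_measurable M.
        (AE z in M. cmod (G z) \<le> cmod (F z)) \<longrightarrow> G \<in> Y \<and> nY G \<le> nY F)"

definition translation_invariant :: "('g::topological_group_add \<Rightarrow> complex) set \<Rightarrow> bool" where
  "translation_invariant Y \<longleftrightarrow>
     (\<forall>F\<in>Y. \<forall>a. (\<lambda>x. F (a + x)) \<in> Y \<and> (\<lambda>x. F (x + a)) \<in> Y)"

text \<open>
  The convolution is only required to exist almost everywhere and to agree almost everywhere with
  an element of \<open>Y\<close>.
\<close>

definition convolution_module ::
    "'g::topological_group_add measure \<Rightarrow> ('g \<Rightarrow> real) \<Rightarrow>
     ('g \<Rightarrow> complex) set \<Rightarrow> (('g \<Rightarrow> complex) \<Rightarrow> real) \<Rightarrow> bool" where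
  "convolution_module M \<nu> Y nY \<longleftrightarrow>
     (\<forall>F\<in>Y. \<forall>G\<in>weighted_L1 M \<nu>. \<exists>H\<in>Y.
        (AE x in M. integrable M (\<lambda>y. F y * G (- y + x)) \<and> H x = group_convolution M F G x) \<and>
        nY H \<le> nY F * weighted_L1_norm M \<nu> G)"

definition absolutely_continuous_norm ::
    "'g measure \<Rightarrow> ('g \<Rightarrow> complex) set \<Rightarrow> (('g \<Rightarrow> complex) \<Rightarrow> real) \<Rightarrow> bool" where
  "absolutely_continuous_norm M Y nY \<longleftrightarrow>
     (\<forall>F\<in>Y. \<forall>E :: nat \<Rightarrow> 'g set.
        (\<forall>n. E n \<in> sets M) \<and> (AE z in M. (\<lambda>n. indicator (E n) z :: real) \<longlonglongrightarrow> 0) \<longrightarrow>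
        (\<lambda>n. nY (\<lambda>z. indicator (E n) z * F z)) \<longlonglongrightarrow> 0)"

section \<open>Group representations\<close>

definition unitary_representation ::
    "('g::topological_group_add \<Rightarrow> 'h::complex_hilbert_space \<Rightarrow> 'h) \<Rightarrow> bool" where
  "unitary_representation \<pi> \<longleftrightarrow>
     (\<forall>z f h. \<pi> z (f + h) = \<pi> z f + \<pi> z h) \<and>
     (\<forall>z c f. \<pi> z (c *\<^sub>C f) = c *\<^sub>C \<pi> z f) \<and>
     (\<forall>z. surj (\<pi> z)) \<and>
     (\<forall>z f h. cinner (\<pi> z f) (\<pi> z h) = cinner f h) \<and>
     (\<forall>f. \<pi> 0 f = f) \<and>
     (\<forall>y z f. \<pi> (y + z) f = \<pi> y (\<pi> z f))"

definition strongly_continuous ::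
    "('g::topological_space \<Rightarrow> 'h::complex_hilbert_space \<Rightarrow> 'h) \<Rightarrow> bool" where
  "strongly_continuous \<pi> \<longleftrightarrow> (\<forall>f. continuous_on UNIV (\<lambda>z. \<pi> z f))"

definition closed_csubspace :: "'h::complex_hilbert_space set \<Rightarrow> bool" where
  "closed_csubspace W \<longleftrightarrow>
     closed W \<and> 0 \<in> W \<and> (\<forall>f\<in>W. \<forall>h\<in>W. f + h \<in> W) \<and> (\<forall>c. \<forall>f\<in>W. c *\<^sub>C f \<in> W)"

definition irreducible_representation ::
    "('g \<Rightarrow> 'h::complex_hilbert_space \<Rightarrow> 'h) \<Rightarrow> bool" where
  "irreducible_representation \<pi> \<longleftrightarrow>
     (\<exists>f::'h. f \<noteq> 0) \<and>
     (\<forall>W. closed_csubspace W \<and> (\<forall>z. \<forall>f\<in>W. \<pi> z f \<in> W) \<longrightarrow> W = {0} \<or> W = UNIV)"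

definition integrable_vector ::
    "'g measure \<Rightarrow> ('g \<Rightarrow> real) \<Rightarrow> ('g \<Rightarrow> 'h::complex_hilbert_space \<Rightarrow> 'h) \<Rightarrow> 'h \<Rightarrow> bool" where
  "integrable_vector M \<nu> \<pi> g \<longleftrightarrow> integrable M (\<lambda>z. cmod (cinner (\<pi> z g) g) * \<nu> z)"

definition integrable_representation ::
    "'g measure \<Rightarrow> ('g \<Rightarrow> real) \<Rightarrow> ('g \<Rightarrow> 'h::complex_hilbert_space \<Rightarrow> 'h) \<Rightarrow> bool" where
  "integrable_representation M \<nu> \<pi> \<longleftrightarrow> (\<exists>g. g \<noteq> 0 \<and> integrable_vector M \<nu> \<pi> g)"

definition rep_coefficient ::
    "('g \<Rightarrow> 'h::complex_hilbert_space \<Rightarrow> 'h) \<Rightarrow> 'h \<Rightarrow> 'h \<Rightarrow> 'g \<Rightarrow> complex" where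
  "rep_coefficient \<pi> g f z = cinner f (\<pi> z g)"

section \<open>Test functions and distributions\<close>

definition test_space ::
    "'g measure \<Rightarrow> ('g \<Rightarrow> real) \<Rightarrow> ('g \<Rightarrow> 'h::complex_hilbert_space \<Rightarrow> 'h) \<Rightarrow> 'h \<Rightarrow> 'h set" where
  "test_space M \<nu> \<pi> g0 = {g. rep_coefficient \<pi> g0 g \<in> weighted_L1 M \<nu>}"

definition test_norm ::
    "'g measure \<Rightarrow> ('g \<Rightarrow> real) \<Rightarrow> ('g \<Rightarrow> 'h::complex_hilbert_space \<Rightarrow> 'h) \<Rightarrow> 'h \<Rightarrow> 'h \<Rightarrow> real" where
  "test_norm M \<nu> \<pi> g0 g = weighted_L1_norm M \<nu> (rep_coefficient \<pi> g0 g)"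

text \<open>
  The bounded conjugate-linear functionals on the test space.  They are extended by \<open>0\<close> outside the
  test space, so that equal functionals are equal as functions.  A vector \<open>f\<close> of the Hilbert space
  corresponds to the functional \<open>cinner f\<close> on the test space.
\<close>

definition distribution_space ::
    "'g measure \<Rightarrow> ('g \<Rightarrow> real) \<Rightarrow> ('g \<Rightarrow> 'h::complex_hilbert_space \<Rightarrow> 'h) \<Rightarrow> 'h
     \<Rightarrow> ('h \<Rightarrow> complex) set" where
  "distribution_space M \<nu> \<pi> g0 =
     {f. (\<forall>h. h \<notin> test_space M \<nu> \<pi> g0 \<longrightarrow> f h = 0) \<and>
         (\<forall>h\<in>test_space M \<nu> \<pi> g0. \<forall>k\<in>test_space M \<nu> \<pi> g0. f (h + k) = f h + f k) \<and>
         (\<forall>h\<in>test_space M \<nu> \<pi> g0. \<forall>c. f (c *\<^sub>C h) = cnj c * f h) \<and>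
         (\<exists>B. \<forall>h\<in>test_space M \<nu> \<pi> g0. cmod (f h) \<le> B * test_norm M \<nu> \<pi> g0 h)}"

definition distribution_norm ::
    "'g measure \<Rightarrow> ('g \<Rightarrow> real) \<Rightarrow> ('g \<Rightarrow> 'h::complex_hilbert_space \<Rightarrow> 'h) \<Rightarrow> 'h
     \<Rightarrow> ('h \<Rightarrow> complex) \<Rightarrow> real" where
  "distribution_norm M \<nu> \<pi> g0 f =
     (SUP h\<in>{h \<in> test_space M \<nu> \<pi> g0. test_norm M \<nu> \<pi> g0 h \<le> 1}. cmod (f h))"

text \<open>
  The voice transform \<open>\<V>\<^sub>g f\<close> of a distribution \<open>f\<close>; it agrees with \<^const>\<open>rep_coefficient\<close> on the
  functionals given by vectors of the Hilbert space.
\<close>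

definition voice_transform ::
    "('g \<Rightarrow> 'h \<Rightarrow> 'h) \<Rightarrow> 'h \<Rightarrow> ('h \<Rightarrow> complex) \<Rightarrow> 'g \<Rightarrow> complex" where
  "voice_transform \<pi> g f z = f (\<pi> z g)"

section \<open>Coorbit spaces\<close>

definition coorbit_space ::
    "'g measure \<Rightarrow> ('g \<Rightarrow> real) \<Rightarrow> ('g \<Rightarrow> 'h::complex_hilbert_space \<Rightarrow> 'h) \<Rightarrow> 'h
     \<Rightarrow> ('g \<Rightarrow> complex) set \<Rightarrow> 'h \<Rightarrow> ('h \<Rightarrow> complex) set" where
  "coorbit_space M \<nu> \<pi> g0 Y g =
     {f \<in> distribution_space M \<nu> \<pi> g0. voice_transform \<pi> g f \<in> Y}"

definition coorbit_norm ::
    "('g \<Rightarrow> 'h \<Rightarrow> 'h) \<Rightarrow> (('g \<Rightarrow> complex) \<Rightarrow> real) \<Rightarrow> 'h \<Rightarrow> ('h \<Rightarrow> complex) \<Rightarrow> real" where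
  "coorbit_norm \<pi> nY g f = nY (voice_transform \<pi> g f)"

text \<open>
  The metric induced by the norm.  The value \<open>0\<close> off the space is immaterial; it is needed because
  \<^locale>\<open>Metric_space\<close> requires nonnegativity and symmetry on the whole type.
\<close>

definition coorbit_dist ::
    "'g measure \<Rightarrow> ('g \<Rightarrow> real) \<Rightarrow> ('g \<Rightarrow> 'h::complex_hilbert_space \<Rightarrow> 'h) \<Rightarrow> 'h
     \<Rightarrow> ('g \<Rightarrow> complex) set \<Rightarrow> (('g \<Rightarrow> complex) \<Rightarrow> real) \<Rightarrow> 'h
     \<Rightarrow> ('h \<Rightarrow> complex) \<Rightarrow> ('h \<Rightarrow> complex) \<Rightarrow> real" where
  "coorbit_dist M \<nu> \<pi> g0 Y nY g f1 f2 =
     (if f1 \<in> coorbit_space M \<nu> \<pi> g0 Y g \<and> f2 \<in> coorbit_space M \<nu> \<pi> g0 Y g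
      then coorbit_norm \<pi> nY g (\<lambda>h. f1 h - f2 h) else 0)"

definition coorbit_topology ::
    "'g measure \<Rightarrow> ('g \<Rightarrow> real) \<Rightarrow> ('g \<Rightarrow> 'h::complex_hilbert_space \<Rightarrow> 'h) \<Rightarrow> 'h
     \<Rightarrow> ('g \<Rightarrow> complex) set \<Rightarrow> (('g \<Rightarrow> complex) \<Rightarrow> real) \<Rightarrow> 'h
     \<Rightarrow> ('h \<Rightarrow> complex) topology" where
  "coorbit_topology M \<nu> \<pi> g0 Y nY g =
     Metric_space.mtopology (coorbit_space M \<nu> \<pi> g0 Y g) (coorbit_dist M \<nu> \<pi> g0 Y nY g)"

text \<open>
  The continuous embedding of the coorbit space into the space of distributions.  Coorbit theory
  provides it for suitably symmetric weights; for a weight that is merely submultiplicative it may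
  fail, and with it completeness of the coorbit space.
\<close>

definition coorbit_embedding ::
    "'g measure \<Rightarrow> ('g \<Rightarrow> real) \<Rightarrow> ('g \<Rightarrow> 'h::complex_hilbert_space \<Rightarrow> 'h) \<Rightarrow> 'h
     \<Rightarrow> ('g \<Rightarrow> complex) set \<Rightarrow> (('g \<Rightarrow> complex) \<Rightarrow> real) \<Rightarrow> 'h \<Rightarrow> bool" where
  "coorbit_embedding M \<nu> \<pi> g0 Y nY g \<longleftrightarrow>
     (\<exists>C. \<forall>f\<in>coorbit_space M \<nu> \<pi> g0 Y g.
        distribution_norm M \<nu> \<pi> g0 f \<le> C * coorbit_norm \<pi> nY g f)"

lemma coorbit_Metric_space:
  assumes bfs: "banach_function_space M Y nY"
    and emb: "coorbit_embedding M \<nu> \<pi> g0 Y nY g"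
    and w: "submultiplicative_weight \<nu>"
  shows "Metric_space (coorbit_space M \<nu> \<pi> g0 Y g) (coorbit_dist M \<nu> \<pi> g0 Y nY g)"
proof -
  let ?X = "coorbit_space M \<nu> \<pi> g0 Y g" and ?d = "coorbit_dist M \<nu> \<pi> g0 Y nY g"
  let ?V = "voice_transform \<pi> g" let ?A = "test_space M \<nu> \<pi> g0" let ?n = "test_norm M \<nu> \<pi> g0"
  have add: "(\<lambda>x. F x + G x) \<in> Y \<and> nY (\<lambda>x. F x + G x) \<le> nY F + nY G" if "F\<in>Y" "G\<in>Y" for F G
    using bfs that unfolding banach_function_space_def by blast
  have mult: "(\<lambda>x. c * F x) \<in> Y \<and> nY (\<lambda>x. c * F x) = cmod c * nY F" if "F\<in>Y" for F c
    using bfs that unfolding banach_function_space_def by blast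
  have nn: "0 \<le> nY F \<and> (nY F = 0 \<longleftrightarrow> (AE x in M. F x = 0))" if "F\<in>Y" for F
    using bfs that unfolding banach_function_space_def by blast
  have diff: "(\<lambda>x. F x - G x) \<in> Y" if "F\<in>Y" "G\<in>Y" for F G
    using add[OF that(1) mult[OF that(2), of "-1", THEN conjunct1]] by simp
  have Vd: "?V (\<lambda>h. f1 h - f2 h) = (\<lambda>z. ?V f1 z - ?V f2 z)" for f1 f2
    by (auto simp: voice_transform_def)
  have X: "?V f \<in> Y" if "f \<in> ?X" for f using that by (auto simp: coorbit_space_def)
  have bnd: "\<exists>B. \<forall>h\<in>?A. cmod (f h) \<le> B * ?n h" if "f \<in> ?X" for f
    using that unfolding coorbit_space_def distribution_space_def by blast
  have dX: "(\<lambda>h. f1 h - f2 h) \<in> ?X" if x: "f1 \<in> ?X" "f2 \<in> ?X" for f1 f2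
  proof -
    obtain B1 where B1: "\<And>h. h\<in>?A \<Longrightarrow> cmod (f1 h) \<le> B1 * ?n h"
      using bnd[OF x(1)] by blast
    obtain B2 where B2: "\<And>h. h\<in>?A \<Longrightarrow> cmod (f2 h) \<le> B2 * ?n h"
      using bnd[OF x(2)] by blast
    have "cmod (f1 h - f2 h) \<le> (B1+B2) * ?n h" if "h\<in>?A" for h
      using B1[OF that] B2[OF that] norm_triangle_ineq4[of "f1 h" "f2 h"] by (simp add: algebra_simps)
    then have "\<exists>B. \<forall>h\<in>?A. cmod (f1 h - f2 h) \<le> B * ?n h" by blast
    then show ?thesis using x diff[OF X X, OF x]
      by (auto simp: coorbit_space_def distribution_space_def Vd algebra_simps)
  qed
  have zero: "f = (\<lambda>_. 0)" if f: "f \<in> ?X" and 0: "nY (?V f) = 0" for f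
  proof
    fix h
    show "f h = 0"
    proof (cases "h \<in> ?A")
      case False then show ?thesis using f by (auto simp: coorbit_space_def distribution_space_def)
    next
      case True
      obtain B where B: "\<And>h. h\<in>?A \<Longrightarrow> cmod (f h) \<le> B * ?n h"
        using bnd[OF f] by blast
      have hom: "f (c *\<^sub>C k) = cnj c * f k" if "k\<in>?A" for c k
        using f that by (auto simp: coorbit_space_def distribution_space_def)
      have n0: "?n k \<ge> 0" for k
      proof -
        have "0 \<le> \<nu> z" for z using w order_trans[OF zero_le_one, of "\<nu> z"]
          unfolding submultiplicative_weight_def by blast
        then show ?thesis unfolding test_norm_def weighted_L1_norm_def
          by (intro integral_nonneg_AE) (auto intro!: mult_nonneg_nonneg)
      qed
      have small: "f k = 0" if k: "k\<in>?A" "?n k \<le> 1" for k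
      proof -
        have "bdd_above ((\<lambda>h. cmod (f h)) ` {h \<in> ?A. ?n h \<le> 1})"
        proof (rule bdd_aboveI2)
          fix h assume h: "h \<in> {h \<in> ?A. ?n h \<le> 1}"
          then have "cmod (f h) \<le> B * ?n h" using B by auto
          also have "\<dots> \<le> \<bar>B\<bar> * 1" using h n0[of h] by (intro mult_mono) auto
          finally show "cmod (f h) \<le> \<bar>B\<bar>" by simp
        qed
        then have "cmod (f k) \<le> distribution_norm M \<nu> \<pi> g0 f"
          unfolding distribution_norm_def using k by (intro cSUP_upper) auto
        also have "\<dots> \<le> 0" using emb f 0 unfolding coorbit_embedding_def coorbit_norm_def by force
        finally show ?thesis by simp
      qed
      show ?thesis
      proof (cases "?n h \<le> 1")
        case True with small \<open>h\<in>?A\<close> show ?thesis by auto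
      next
        case False
        have RR: "rep_coefficient \<pi> g0 (c *\<^sub>C h) = (\<lambda>z. c * rep_coefficient \<pi> g0 h z)" for c
          by (auto simp: rep_coefficient_def cinner_scaleC_left)
        have AA: "c *\<^sub>C h \<in> ?A" for c using True
          by (auto simp: test_space_def weighted_L1_def RR norm_mult mult.assoc)
        have NN: "?n (c *\<^sub>C h) = cmod c * ?n h" for c
          unfolding test_norm_def weighted_L1_norm_def RR by (simp add: norm_mult mult.assoc)
        let ?c = "complex_of_real (1 / ?n h)"
        have R: "rep_coefficient \<pi> g0 (?c *\<^sub>C h) = (\<lambda>z. ?c * rep_coefficient \<pi> g0 h z)"
          by (rule RR)
        have "?c *\<^sub>C h \<in> ?A" by (rule AA)
        moreover have "?n (?c *\<^sub>C h) = 1"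
        proof -
          have "?n (?c *\<^sub>C h) = cmod ?c * ?n h"
            by (rule NN)
          then show ?thesis using False by (simp add: norm_divide)
        qed
        ultimately have "f (?c *\<^sub>C h) = 0" using small by auto
        then show ?thesis using hom[OF True, of ?c] False n0[of h] by auto
      qed
    qed
  qed
  have dsym: "nY (\<lambda>x. F x - G x) = nY (\<lambda>x. G x - F x)" if "F\<in>Y" "G\<in>Y" for F G
    using mult[OF diff[OF that], of "-1"] by simp
  show ?thesis
  proof
    show "0 \<le> ?d x y" for x y using nn[OF X[OF dX]] by (auto simp: coorbit_dist_def coorbit_norm_def)
    show "?d x y = ?d y x" for x y using dsym[OF X X, of x y]
      by (auto simp: coorbit_dist_def coorbit_norm_def Vd)
    show "?d x y = 0 \<longleftrightarrow> x = y" if "x\<in>?X" "y\<in>?X" for x y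
    proof
      assume "?d x y = 0"
      then have "(\<lambda>h. x h - y h) = (\<lambda>_. 0)" using zero[OF dX[OF that]] that
        by (auto simp: coorbit_dist_def coorbit_norm_def)
      then show "x = y" by (auto simp: fun_eq_iff)
    next
      assume "x = y" then show "?d x y = 0"
        using nn[OF X[OF dX[OF that]]] that by (auto simp: coorbit_dist_def coorbit_norm_def voice_transform_def)
    qed
    show "?d x z \<le> ?d x y + ?d y z" if "x\<in>?X" "y\<in>?X" "z\<in>?X" for x y z
      using add[OF diff[OF X[OF that(1)] X[OF that(2)]] diff[OF X[OF that(2)] X[OF that(3)]]] that
      by (auto simp: coorbit_dist_def coorbit_norm_def Vd)
  qed
qed

end

theory Submission
  imports Defs
begin

text \<open>
  Write \<open>V f\<close> for the voice transform of \<open>f\<close>.  The coorbit space is a complete metric space, so a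
  closed set \<open>S\<close> is compact iff it is totally bounded, and the theorem compares total boundedness
  with uniformly small tails of \<open>V f\<close>, \<open>f \<in> S\<close>.

  Small tails imply total boundedness by an Arzela--Ascoli argument.  By the embedding into the
  distributions, a bounded set of the coorbit space is bounded in the dual of the test space.  Since
  \<open>z \<mapsto> \<pi> z g\<close> is continuous for the norm of the test space
  (\<open>test_norm_orbit_continuous\<close>), the functions \<open>V f\<close> are equicontinuous and pointwise
  bounded, and finitely many of them approximate all of them uniformly on a compact set \<open>U\<close>
  (\<open>equicontinuous_finite_net\<close>).  On \<open>U\<close> the uniform norm controls the norm of \<open>Y\<close>, because the
  indicator of \<open>U\<close> lies in \<open>Y\<close> unless all \<open>V f\<close> vanish (\<open>indicator_compact_in_Y\<close>); off \<open>U\<close>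
  the tails are small.  Continuity of the orbit map is continuity of translations in weighted
  \<open>L\<^sup>1\<close>, applied to the continuous function \<open>z \<mapsto> cinner g (\<pi> z g0)\<close>.

  Conversely, by total boundedness it suffices that a single \<open>F = V f\<close> has small tails
  (\<open>small_outside_compact\<close>).  If the group is \<open>\<sigma>\<close>-compact, this is the absolute continuity of the
  norm along a compact exhaustion.  In general, the cosets of an open \<open>\<sigma>\<close>-compact subgroup
  partition the group, and absolute continuity leaves only countably many cosets on which \<open>F\<close>
  has nonzero norm.  As \<open>F\<close> is continuous and nonempty open sets have positive measure, \<open>F\<close>
  vanishes identically on all others, hence off a \<open>\<sigma>\<close>-compact set.

  For completeness (\<open>coorbit_complete\<close>), a Cauchy sequence converges pointwise on the test space to
  a distribution, and its voice transforms converge both pointwise and in the norm of \<open>Y\<close>; the two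
  limits agree almost everywhere (\<open>pointwise_limit_in_Y\<close>).
\<close>

section \<open>Compact sets and cosets in topological groups\<close>

lemma compact_add:
  fixes A B :: "'g::{topological_group_add,t2_space} set"
  assumes "compact A" "compact B"
  shows "compact ((\<lambda>p. fst p + snd p) ` (A \<times> B))"
  by (intro compact_continuous_image continuous_intros compact_Times assms)

text \<open>
  The set is the left translate \<open>a + W\<close>, written as a preimage so that continuity applies.
\<close>

lemma open_left_coset:
  fixes W :: "'g::topological_group_add set"
  assumes "open W"
  shows "open {x. - a + x \<in> W}"
proof -
  have "open ((\<lambda>x. - a + x) -` W)"
    by (intro open_vimage assms continuous_intros)
  then show ?thesis by (simp add: vimage_def)
qed

fun sumset_power :: "'g::topological_group_add set \<Rightarrow> nat \<Rightarrow> 'g set" where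
  "sumset_power K 0 = {0}"
| "sumset_power K (Suc n) = (\<lambda>p. fst p + snd p) ` (sumset_power K n \<times> K)"

lemma compact_sumset_power:
  fixes K :: "'g::{topological_group_add,t2_space} set"
  shows "compact K \<Longrightarrow> compact (sumset_power K n)"
  by (induction n) (auto intro: compact_add)

lemma sumset_power_add:
  assumes "x \<in> sumset_power K m" "y \<in> sumset_power K n"
  shows "x + y \<in> sumset_power K (m + n)"
  using assms
proof (induction n arbitrary: y)
  case (Suc n)
  then obtain p k where y: "y = p + k" "p \<in> sumset_power K n" "k \<in> K" by auto
  then have "x + p \<in> sumset_power K (m + n)" using Suc by blast
  then show ?case using y by (force simp: add.assoc[symmetric])
qed auto

lemma sumset_power_minus:
  assumes K: "\<And>k. k \<in> K \<Longrightarrow> - k \<in> K" and "x \<in> sumset_power K n"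
  shows "- x \<in> sumset_power K n"
  using assms(2)
proof (induction n arbitrary: x)
  case (Suc n)
  then obtain p k where x: "x = p + k" "p \<in> sumset_power K n" "k \<in> K" by auto
  have "- k \<in> sumset_power K 1" using K[OF x(3)] by force
  then have "- k + - p \<in> sumset_power K (1 + n)" using Suc.IH[OF x(2)] by (rule sumset_power_add)
  then show ?case by (simp add: x(1) minus_add)
qed auto

text \<open>
  The subgroup is generated by a compact neighbourhood of \<open>0\<close>: its sumset powers are compact, and a
  subgroup that contains a neighbourhood of \<open>0\<close> is open.
\<close>

lemma open_sigma_compact_subgroup:
  assumes "locally_compact_space (euclidean :: 'g::{topological_group_add,t2_space} topology)"
  obtains P :: "nat \<Rightarrow> 'g::{topological_group_add,t2_space} set" and H where
    "\<And>n. compact (P n)" "H = (\<Union>n. P n)" "open H" "0 \<in> H"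
    "\<And>x y. x \<in> H \<Longrightarrow> y \<in> H \<Longrightarrow> x + y \<in> H" "\<And>x. x \<in> H \<Longrightarrow> - x \<in> H"
proof -
  obtain W K :: "'g::{topological_group_add,t2_space} set" where WK: "open W" "compact K" "0 \<in> W" "W \<subseteq> K"
    using assms unfolding locally_compact_space_def
    by (metis UNIV_I compactin_euclidean_iff open_openin topspace_euclidean)
  define K' where "K' = K \<union> uminus ` K"
  have K'c: "compact K'" unfolding K'_def
    by (intro compact_Un WK compact_continuous_image continuous_intros)
  have K'm: "- k \<in> K'" if "k \<in> K'" for k using that by (auto simp: K'_def)
  let ?H = "\<Union>n. sumset_power K' n"
  have add: "x + y \<in> ?H" if "x \<in> ?H" "y \<in> ?H" for x y
    using that sumset_power_add by blast
  have minus: "- x \<in> ?H" if "x \<in> ?H" for x using that sumset_power_minus[OF K'm] by blast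
  have W: "W \<subseteq> ?H"
  proof
    fix x assume "x \<in> W"
    then have "x \<in> sumset_power K' 1" using WK by (force simp: K'_def)
    then show "x \<in> ?H" by blast
  qed
  have "open ?H"
  proof (subst open_subopen, intro ballI)
    fix x assume x: "x \<in> ?H"
    have "{y. - x + y \<in> W} \<subseteq> ?H"
    proof
      fix y assume "y \<in> {y. - x + y \<in> W}"
      then have "x + (- x + y) \<in> ?H" by (intro add[OF x]) (use W in blast)
      then show "y \<in> ?H" by (simp add: add.assoc[symmetric])
    qed
    then show "\<exists>T. open T \<and> x \<in> T \<and> T \<subseteq> ?H" 
      using WK by (intro exI[of _ "{y. - x + y \<in> W}"]) (auto intro: open_left_coset)
  qed
  moreover have "0 \<in> ?H" using WK W by blast
  ultimately show ?thesis
    using that[of "sumset_power K'" ?H] compact_sumset_power[OF K'c] add minus by blast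
qed

text \<open>
  The pieces are the left cosets of an open \<open>\<sigma>\<close>-compact subgroup.
\<close>

lemma partition_into_sigma_compact_open:
  assumes lc: "locally_compact_space (euclidean :: 'g::{topological_group_add,t2_space} topology)"
  obtains \<C> :: "'g::{topological_group_add,t2_space} set set" where
    "\<Union>\<C> = UNIV" "disjoint \<C>"
    "\<And>C. C \<in> \<C> \<Longrightarrow> open C"
    "\<And>C. C \<in> \<C> \<Longrightarrow> \<exists>P :: nat \<Rightarrow> 'g::{topological_group_add,t2_space} set. (\<forall>n. compact (P n)) \<and> C = (\<Union>n. P n)"
proof -
  obtain P :: "nat \<Rightarrow> 'g::{topological_group_add,t2_space} set" and H where H:
    "\<And>n. compact (P n)" "H = (\<Union>n. P n)" "open H" "0 \<in> H"
    "\<And>x y. x \<in> H \<Longrightarrow> y \<in> H \<Longrightarrow> x + y \<in> H" "\<And>x. x \<in> H \<Longrightarrow> - x \<in> H"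
    using open_sigma_compact_subgroup[OF lc] by metis
  define c where "c a = {x. - a + x \<in> H}" for a
  have eq: "c a = c b" if "x \<in> c a" "x \<in> c b" for a b x
  proof -
    have *: "c a \<subseteq> c b" if "x \<in> c a" "x \<in> c b" for a b
    proof
      fix y assume "y \<in> c a"
      then have "(- b + x) + (- (- a + x) + (- a + y)) \<in> H"
        using that H(5,6) by (simp add: c_def)
      then show "y \<in> c b" by (simp add: c_def minus_add add.assoc[symmetric])
    qed
    show ?thesis using *[OF that] *[OF that(2,1)] by blast
  qed
  have sc: "\<exists>P. (\<forall>n. compact (P n)) \<and> c a = (\<Union>n::nat. P n)" for a
  proof (intro exI conjI allI)
    show "compact ((\<lambda>x. a + x) ` P n)" for n
      by (intro compact_continuous_image H continuous_intros)
    show "c a = (\<Union>n. (\<lambda>x. a + x) ` P n)"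
    proof
      show "c a \<subseteq> (\<Union>n. (\<lambda>x. a + x) ` P n)"
      proof
        fix x assume "x \<in> c a"
        then obtain n where "- a + x \<in> P n" using H(2) by (auto simp: c_def)
        then have "a + (- a + x) \<in> (\<lambda>x. a + x) ` P n" by blast
        then show "x \<in> (\<Union>n. (\<lambda>x. a + x) ` P n)" by (auto simp: add.assoc[symmetric])
      qed
      show "(\<Union>n. (\<lambda>x. a + x) ` P n) \<subseteq> c a"
        using H(2) by (auto simp: c_def add.assoc[symmetric])
    qed
  qed
  show ?thesis
  proof (rule that[of "range c"])
    have "a \<in> c a" for a using H(4) by (simp add: c_def)
    then show "\<Union>(range c) = UNIV" by blast
    show "disjoint (range c)" using eq by (auto simp: disjoint_def)
    show "open C" if "C \<in> range c" for C
      using that open_left_coset[OF H(3)] by (auto simp: c_def)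
    show "\<exists>P :: nat \<Rightarrow> 'g::{topological_group_add,t2_space} set. (\<forall>n. compact (P n)) \<and> C = (\<Union>n. P n)" if "C \<in> range c" for C
      using that sc by blast
  qed
qed

section \<open>Equicontinuous families on compact sets\<close>

text \<open>
  The Arzela--Ascoli theorem in the form of a finite net, for a family indexed by an arbitrary set
  on a space without a metric.  Equicontinuity reduces the compact set \<open>U\<close> to finitely many points
  \<open>Z\<close>; each index is encoded by centres near its values on \<open>Z\<close>, and there are only finitely many
  codes, so one representative of each code suffices.
\<close>

lemma equicontinuous_finite_net:
  fixes \<Phi> :: "'i \<Rightarrow> 'a::topological_space \<Rightarrow> complex"
  assumes U: "compact U"
    and bdd: "\<And>z. z \<in> U \<Longrightarrow> bounded ((\<lambda>i. \<Phi> i z) ` S)"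
    and equi: "\<And>z e. 0 < e \<Longrightarrow> \<exists>W. open W \<and> z \<in> W \<and> (\<forall>w\<in>W. \<forall>i\<in>S. cmod (\<Phi> i w - \<Phi> i z) < e)"
    and e: "0 < e"
  shows "\<exists>T\<subseteq>S. finite T \<and> (\<forall>i\<in>S. \<exists>t\<in>T. \<forall>z\<in>U. cmod (\<Phi> i z - \<Phi> t z) < e)"
proof -
  have "\<forall>z. \<exists>W. open W \<and> z \<in> W \<and> (\<forall>w\<in>W. \<forall>i\<in>S. cmod (\<Phi> i w - \<Phi> i z) < e/4)"
    using equi[of "e/4"] e by simp
  then obtain W where W: "\<And>z. open (W z)" "\<And>z. z \<in> W z"
    "\<And>z w i. w \<in> W z \<Longrightarrow> i \<in> S \<Longrightarrow> cmod (\<Phi> i w - \<Phi> i z) < e/4" by metis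
  obtain Z where Z: "Z \<subseteq> U" "finite Z" "U \<subseteq> (\<Union>z\<in>Z. W z)"
    by (rule compactE_image[OF U, of U W]) (use W(1,2) in auto)
  have "\<forall>z\<in>U. \<exists>k. finite k \<and> (\<lambda>i. \<Phi> i z) ` S \<subseteq> (\<Union>x\<in>k. ball x (e/4))"
  proof
    fix z assume "z \<in> U"
    then have "compact (closure ((\<lambda>i. \<Phi> i z) ` S))" using bdd by (simp add: compact_closure)
    then have "\<exists>k. finite k \<and> closure ((\<lambda>i. \<Phi> i z) ` S) \<subseteq> (\<Union>x\<in>k. ball x (e/4))"
      using e unfolding compact_eq_totally_bounded by auto
    then show "\<exists>k. finite k \<and> (\<lambda>i. \<Phi> i z) ` S \<subseteq> (\<Union>x\<in>k. ball x (e/4))"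
      using closure_subset by (meson order_trans)
  qed
  then obtain k where k: "\<And>z. z \<in> U \<Longrightarrow> finite (k z)"
    "\<And>z. z \<in> U \<Longrightarrow> (\<lambda>i. \<Phi> i z) ` S \<subseteq> (\<Union>x\<in>k z. ball x (e/4))" by metis
  have "\<forall>i\<in>S. \<forall>z\<in>U. \<exists>x\<in>k z. cmod (\<Phi> i z - x) < e/4"
  proof (intro ballI)
    fix i z assume "i \<in> S" "z \<in> U"
    then have "\<Phi> i z \<in> (\<Union>x\<in>k z. ball x (e/4))" using k(2) by blast
    then obtain x where "x \<in> k z" "dist x (\<Phi> i z) < e/4" by auto
    then show "\<exists>x\<in>k z. cmod (\<Phi> i z - x) < e/4"
      by (intro bexI[of _ x]) (simp_all add: dist_norm norm_minus_commute)
  qed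
  then obtain c where c: "\<And>i z. i \<in> S \<Longrightarrow> z \<in> U \<Longrightarrow> c i z \<in> k z \<and> cmod (\<Phi> i z - c i z) < e/4"
    by metis
  \<comment> \<open>Restriction to \<open>Z\<close> makes codes that agree on \<open>Z\<close> equal, so that finitely many codes remain.\<close>
  define code where "code i = restrict (c i) Z" for i
  have "code ` S \<subseteq> PiE Z k" using c Z(1) by (auto simp: code_def)
  moreover have "finite (PiE Z k)" using Z k(1) by (intro finite_PiE) auto
  ultimately have fin: "finite (code ` S)" by (rule finite_subset)
  obtain T where T: "T \<subseteq> S" "finite T" "code ` S = code ` T"
    using finite_subset_image[OF fin order_refl] by metis
  show ?thesis
  proof (intro exI[of _ T] conjI ballI T)
    fix i assume i: "i \<in> S"
    then obtain t where t: "t \<in> T" "code i = code t" using T(3) by blast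
    show "\<exists>t\<in>T. \<forall>z\<in>U. cmod (\<Phi> i z - \<Phi> t z) < e"
    proof (intro bexI[OF _ t(1)] ballI)
      fix z assume "z \<in> U"
      then obtain y where y: "y \<in> Z" "z \<in> W y" using Z by blast
      have tS: "t \<in> S" and yU: "y \<in> U" using t T y Z by auto
      have c_eq: "c i y = c t y" using fun_cong[OF t(2), of y] y(1) by (simp add: code_def)
      have "\<Phi> i z - \<Phi> t z =
          ((\<Phi> i z - \<Phi> i y) + (\<Phi> i y - c i y)) - ((\<Phi> t z - \<Phi> t y) + (\<Phi> t y - c t y))"
        by (simp add: c_eq)
      also have "cmod \<dots> \<le> (cmod (\<Phi> i z - \<Phi> i y) + cmod (\<Phi> i y - c i y))
          + (cmod (\<Phi> t z - \<Phi> t y) + cmod (\<Phi> t y - c t y))"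
        by (rule order_trans[OF norm_triangle_ineq4 add_mono[OF norm_triangle_ineq norm_triangle_ineq]])
      also have "\<dots> < (e/4 + e/4) + (e/4 + e/4)"
        using W(3)[OF y(2) i] W(3)[OF y(2) tS] c[OF i yU] c[OF tS yU]
        by (intro add_strict_mono) auto
      finally show "cmod (\<Phi> i z - \<Phi> t z) < e" by simp
    qed
  qed
qed

section \<open>Haar measure\<close>

locale haar_measure =
  fixes M :: "'g::{topological_group_add,t2_space} measure"
  assumes haar: "left_haar_measure M"
begin

lemma sets_M [measurable_cong, simp]: "sets M = sets borel"
  using haar by (simp add: left_haar_measure_def)

lemma space_M [simp]: "space M = UNIV"
  using sets_eq_imp_space_eq[OF sets_M] by simp

lemma emeasure_compact: "compact K \<Longrightarrow> emeasure M K < \<infinity>"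
  using haar by (simp add: left_haar_measure_def)

lemma inner_regular_open: "open U \<Longrightarrow> emeasure M U = (SUP K\<in>{K. compact K \<and> K \<subseteq> U}. emeasure M K)"
  using haar by (auto simp: left_haar_measure_def)

lemma distr_left_translation: "distr M borel (\<lambda>x. a + x) = M"
proof (rule measure_eqI)
  show "sets (distr M borel (\<lambda>x. a + x)) = sets M" by simp
  fix A assume "A \<in> sets (distr M borel (\<lambda>x. a + x))"
  then have A: "A \<in> sets borel" by simp
  have m: "(\<lambda>x. a + x) \<in> measurable M borel"
    unfolding measurable_cong_sets[OF sets_M refl]
    by (intro borel_measurable_continuous_onI continuous_intros)
  have "(\<lambda>x. a + x) -` A = (\<lambda>x. - a + x) ` A"
  proof (intro set_eqI iffI)
    fix x assume "x \<in> (\<lambda>x. a + x) -` A"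
    then have "- a + (a + x) \<in> (\<lambda>x. - a + x) ` A" by blast
    then show "x \<in> (\<lambda>x. - a + x) ` A" by (simp add: add.assoc[symmetric])
  qed (auto simp: add.assoc[symmetric])
  then have "emeasure (distr M borel (\<lambda>x. a + x)) A = emeasure M ((\<lambda>x. - a + x) ` A)"
    using A by (simp add: emeasure_distr[OF m])
  also have "\<dots> = emeasure M A" using haar A by (simp add: left_haar_measure_def)
  finally show "emeasure (distr M borel (\<lambda>x. a + x)) A = emeasure M A" .
qed

lemma measurable_left_translation [measurable]: "(\<lambda>x. a + x) \<in> measurable M M"
  unfolding measurable_cong_sets[OF sets_M sets_M]
  by (intro borel_measurable_continuous_onI continuous_intros)

lemma nn_integral_left_translation:
  assumes "h \<in> borel_measurable borel"
  shows "(\<integral>\<^sup>+x. h (a + x) \<partial>M) = (\<integral>\<^sup>+x. h x \<partial>M)"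
proof -
  have "(\<integral>\<^sup>+x. h x \<partial>M) = (\<integral>\<^sup>+x. h x \<partial>distr M borel (\<lambda>x. a + x))"
    by (simp add: distr_left_translation)
  also have "\<dots> = (\<integral>\<^sup>+x. h (a + x) \<partial>M)"
    using measurable_left_translation[of a] assms
    by (intro nn_integral_distr) (auto simp: measurable_cong_sets[OF refl sets_M])
  finally show ?thesis ..
qed

lemma emeasure_left_coset:
  assumes "A \<in> sets borel"
  shows "emeasure M {x. - a + x \<in> A} = emeasure M A"
proof -
  have "emeasure M A = emeasure (distr M borel (\<lambda>x. - a + x)) A" by (simp add: distr_left_translation)
  also have "\<dots> = emeasure M ((\<lambda>x. - a + x) -` A \<inter> space M)"
    using measurable_left_translation[of "- a"] assms
    by (intro emeasure_distr) (auto simp: measurable_cong_sets[OF refl sets_M])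
  finally show ?thesis by (simp add: vimage_def)
qed

text \<open>
  If some nonempty open \<open>W\<close> were null, then every compact set, being covered by finitely many
  translates of \<open>W\<close>, would be null, and by inner regularity so would the whole group.
\<close>

lemma open_null_empty:
  assumes W: "open W" and null: "emeasure M W = 0"
  shows "W = {}"
proof (rule ccontr)
  assume "W \<noteq> {}"
  then obtain w where w: "w \<in> W" by blast
  have "emeasure M K = 0" if K: "compact K" for K
  proof -
    \<comment> \<open>The translate of \<open>W\<close> that moves \<open>w \<in> W\<close> to \<open>a\<close>.\<close>
    let ?T = "\<lambda>a. {x. - (a - w) + x \<in> W}"
    have aT: "a \<in> ?T a" for a using w by (simp add: minus_diff_eq add.assoc[symmetric])
    obtain Z where Z: "Z \<subseteq> K" "finite Z" "K \<subseteq> (\<Union>z\<in>Z. ?T z)"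
    proof (rule compactE_image[OF K, of K ?T])
      show "open (?T a)" for a by (rule open_left_coset[OF W])
      show "K \<subseteq> (\<Union>a\<in>K. ?T a)" using aT by blast
    qed
    have Tn: "?T z \<in> null_sets M" for z
      using emeasure_left_coset[of W "z - w"] open_left_coset[OF W, of "z - w"] W null
      by (auto simp: null_sets_def)
    have "(\<Union>z\<in>Z. ?T z) \<in> null_sets M" using Tn Z(2) by (intro null_sets.finite_UN) auto
    moreover have "K \<in> sets M" using compact_imp_closed[OF K] by simp
    ultimately have "K \<in> null_sets M" using Z(3) by (meson null_sets_subset)
    then show ?thesis by auto
  qed
  then have "emeasure M UNIV = 0"
    using inner_regular_open[of UNIV] by (simp add: bot_ennreal[symmetric])
  then show False using haar by (simp add: left_haar_measure_def)
qed

end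

section \<open>Translation in weighted L1 spaces\<close>

context haar_measure begin

text \<open>
  Both the large and the small values of \<open>h\<close> carry little of the integral.  The remaining set, where
  \<open>h\<close> lies strictly between two positive bounds, is open with finite measure, hence exhausted by a
  compact set up to small measure; the upper bound on \<open>h\<close> turns small measure into a small integral.
\<close>

lemma compact_concentration:
  fixes h :: "'g \<Rightarrow> real"
  assumes cont: "continuous_on UNIV h" and nn: "\<And>x. 0 \<le> h x"
    and int: "(\<integral>\<^sup>+x. h x \<partial>M) < \<infinity>" and e: "0 < e"
  shows "\<exists>K. compact K \<and> (\<integral>\<^sup>+x. ennreal (h x) * indicator (- K) x \<partial>M) < ennreal e"
proof -
  define B where "B n = {x. 1 / real (Suc n) < h x \<and> h x < real (Suc n)}" for n
  have opB: "open (B n)" for n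
    unfolding B_def by (intro open_Collect_conj open_Collect_less cont continuous_intros)
  have [measurable]: "h \<in> borel_measurable M"
    using cont by (simp add: borel_measurable_continuous_onI cong: measurable_cong_sets)
  have [measurable]: "B n \<in> sets M" for n using opB by simp
  have "(\<lambda>n. \<integral>\<^sup>+x. ennreal (h x) * indicator (- B n) x \<partial>M) \<longlonglongrightarrow> (\<integral>\<^sup>+x. 0 \<partial>M)"
  proof (rule nn_integral_dominated_convergence[where w = "\<lambda>x. ennreal (h x)"])
    show "AE x in M. (\<lambda>n. ennreal (h x) * indicator (- B n) x) \<longlonglongrightarrow> 0"
    proof (intro AE_I2)
      fix x
      show "(\<lambda>n. ennreal (h x) * indicator (- B n) x) \<longlonglongrightarrow> 0"
      proof (cases "h x = 0")
        case False
        then have "0 < h x" using nn[of x] by simp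
        have "eventually (\<lambda>n. 1 / real (Suc n) < h x) sequentially"
          using \<open>0 < h x\<close> order_tendstoD(2)[OF LIMSEQ_inverse_real_of_nat, of "h x"]
          by (simp add: inverse_eq_divide)
        moreover have "eventually (\<lambda>n. h x < real (Suc n)) sequentially"
        proof -
          obtain N where "h x < real N" using reals_Archimedean2 by blast
          then show ?thesis by (auto simp: eventually_sequentially intro!: exI[of _ N])
        qed
        ultimately have "eventually (\<lambda>n. ennreal (h x) * indicator (- B n) x = 0) sequentially"
          by eventually_elim (simp add: B_def)
        then show ?thesis by (rule tendsto_eventually)
      qed simp
    qed
  qed (use int in \<open>auto simp: indicator_def\<close>)
  then have "eventually (\<lambda>n. (\<integral>\<^sup>+x. ennreal (h x) * indicator (- B n) x \<partial>M) < ennreal (e/2)) sequentially"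
    using e by (intro order_tendstoD(2)) auto
  then obtain n where n: "(\<integral>\<^sup>+x. ennreal (h x) * indicator (- B n) x \<partial>M) < ennreal (e/2)"
    by (auto simp: eventually_sequentially)
  let ?m = "real (Suc n)"
  have "emeasure M (B n) = (\<integral>\<^sup>+x. indicator (B n) x \<partial>M)" by (intro nn_integral_indicator[symmetric]) measurable
  also have "\<dots> \<le> (\<integral>\<^sup>+x. ennreal ?m * ennreal (h x) \<partial>M)"
  proof (rule nn_integral_mono)
    fix x
    show "indicator (B n) x \<le> ennreal ?m * ennreal (h x)"
    proof (cases "x \<in> B n")
      case True
      then have "1 \<le> ?m * h x" by (simp add: B_def field_simps)
      then have "ennreal 1 \<le> ennreal (?m * h x)" by (rule ennreal_leI)
      then show ?thesis using True nn[of x] by (simp add: ennreal_mult del: of_nat_Suc)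
    qed simp
  qed
  also have "\<dots> = ennreal ?m * (\<integral>\<^sup>+x. h x \<partial>M)" by (simp add: nn_integral_cmult)
  also have "\<dots> < \<infinity>" using int by (simp add: ennreal_mult_less_top)
  finally have fin: "emeasure M (B n) < \<infinity>" .
  have "\<exists>K\<in>{K. compact K \<and> K \<subseteq> B n}. emeasure M (B n) < emeasure M K + ennreal (e / (2 * ?m))"
    using e fin by (intro SUP_approx_ennreal inner_regular_open opB) auto
  then obtain K where K: "compact K" "K \<subseteq> B n" "emeasure M (B n) < emeasure M K + ennreal (e / (2 * ?m))"
    by blast
  have [measurable]: "K \<in> sets M" using compact_imp_closed[OF K(1)] by simp
  have "emeasure M (B n - K) = emeasure M (B n) - emeasure M K"
    using K(2) emeasure_compact[OF K(1)] by (intro emeasure_Diff \<open>B n \<in> sets M\<close> \<open>K \<in> sets M\<close>) auto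
  also have "\<dots> \<le> ennreal (e / (2 * ?m))"
    using K(3) fin by (auto simp: ennreal_minus_le_iff)
  finally have small: "emeasure M (B n - K) \<le> ennreal (e / (2 * ?m))" .
  have "(\<integral>\<^sup>+x. ennreal (h x) * indicator (- K) x \<partial>M)
      \<le> (\<integral>\<^sup>+x. ennreal (h x) * indicator (- B n) x + ennreal ?m * indicator (B n - K) x \<partial>M)"
  proof (rule nn_integral_mono)
    fix x
    show "ennreal (h x) * indicator (- K) x \<le> ennreal (h x) * indicator (- B n) x + ennreal ?m * indicator (B n - K) x"
    proof (cases "x \<in> B n")
      case True
      then have "h x \<le> ?m" by (simp add: B_def)
      then have "ennreal (h x) \<le> ennreal ?m" by (rule ennreal_leI)
      then show ?thesis using True by (simp add: indicator_def)
    qed (simp add: indicator_def)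
  qed
  also have "\<dots> = (\<integral>\<^sup>+x. ennreal (h x) * indicator (- B n) x \<partial>M) + ennreal ?m * emeasure M (B n - K)"
  proof (subst nn_integral_add)
    have "B n - K \<in> sets M" by measurable
    then show "(\<integral>\<^sup>+x. ennreal (h x) * indicator (- B n) x \<partial>M) + (\<integral>\<^sup>+x. ennreal ?m * indicator (B n - K) x \<partial>M)
        = (\<integral>\<^sup>+x. ennreal (h x) * indicator (- B n) x \<partial>M) + ennreal ?m * emeasure M (B n - K)"
      by (simp only: nn_integral_cmult_indicator)
  qed measurable
  also have "\<dots> \<le> (\<integral>\<^sup>+x. ennreal (h x) * indicator (- B n) x \<partial>M) + ennreal ?m * ennreal (e / (2 * ?m))"
    using small by (intro add_left_mono mult_left_mono) auto
  also have "\<dots> = (\<integral>\<^sup>+x. ennreal (h x) * indicator (- B n) x \<partial>M) + ennreal (e/2)"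
    using e by (simp add: ennreal_mult[symmetric] del: of_nat_Suc)
  also have "\<dots> < ennreal (e/2) + ennreal (e/2)"
    using n by (simp add: ennreal_add_left_cancel_less add.commute)
  also have "\<dots> = ennreal e" using e by (simp add: ennreal_plus[symmetric] del: ennreal_plus)
  finally show ?thesis using K(1) by blast
qed

end

locale weighted_group = haar_measure M
  for M :: "'g::{topological_group_add,t2_space} measure" +
  fixes \<nu> :: "'g \<Rightarrow> real"
  assumes lc: "locally_compact_space (euclidean :: 'g topology)"
    and weight: "submultiplicative_weight \<nu>"
begin

lemma weight_cont: "continuous_on UNIV \<nu>"
  and weight_mult: "\<nu> (x + y) \<le> \<nu> x * \<nu> y"
  and weight_ge1: "1 \<le> \<nu> x"
  using weight by (auto simp: submultiplicative_weight_def)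

lemma weight_nonneg [simp]: "0 \<le> \<nu> x" and weight_pos [simp]: "0 < \<nu> x"
  using weight_ge1[of x] by linarith+

lemma measurable_weight [measurable]: "\<nu> \<in> borel_measurable M"
  using weight_cont by (simp add: borel_measurable_continuous_onI cong: measurable_cong_sets)

lemma weight_bounded_on_compact:
  assumes "compact K"
  obtains C where "1 \<le> C" "\<And>x. x \<in> K \<Longrightarrow> \<nu> x \<le> C"
proof -
  have "compact (\<nu> ` K)"
    by (intro compact_continuous_image assms continuous_on_subset[OF weight_cont]) auto
  then obtain C where "\<And>y. y \<in> \<nu> ` K \<Longrightarrow> y \<le> C"
    using compact_imp_bounded bounded_imp_bdd_above unfolding bdd_above_def by meson
  then show ?thesis using that[of "max 1 C"] by (meson imageI max.coboundedI2 max.cobounded1)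
qed

text \<open>
  Translation by \<open>z\<close> is bounded on the weighted space with norm at most \<open>\<nu> z\<close>; this uses left
  invariance of the measure and \<open>\<nu> x \<le> \<nu> z * \<nu> (- z + x)\<close>.
\<close>

lemma weighted_integral_translation_le:
  assumes [measurable]: "h \<in> borel_measurable borel"
  shows "(\<integral>\<^sup>+x. h (- z + x) * ennreal (\<nu> x) \<partial>M) \<le> ennreal (\<nu> z) * (\<integral>\<^sup>+x. h x * ennreal (\<nu> x) \<partial>M)"
proof -
  have [measurable]: "h \<in> borel_measurable M" "\<nu> \<in> borel_measurable borel" using assms weight_cont
    by (auto simp: borel_measurable_continuous_onI cong: measurable_cong_sets)
  have "h (- z + x) * ennreal (\<nu> x) \<le> ennreal (\<nu> z) * (h (- z + x) * ennreal (\<nu> (- z + x)))" for x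
  proof -
    have "\<nu> x \<le> \<nu> z * \<nu> (- z + x)"
      using weight_mult[of z "- z + x"] by (simp add: add.assoc[symmetric])
    then have "ennreal (\<nu> x) \<le> ennreal (\<nu> z) * ennreal (\<nu> (- z + x))"
      by (simp add: ennreal_mult[symmetric] ennreal_leI)
    then have "h (- z + x) * ennreal (\<nu> x) \<le> h (- z + x) * (ennreal (\<nu> z) * ennreal (\<nu> (- z + x)))"
      by (intro mult_left_mono) auto
    then show ?thesis by (simp add: ac_simps)
  qed
  then have "(\<integral>\<^sup>+x. h (- z + x) * ennreal (\<nu> x) \<partial>M)
      \<le> (\<integral>\<^sup>+x. ennreal (\<nu> z) * (h (- z + x) * ennreal (\<nu> (- z + x))) \<partial>M)"
    by (intro nn_integral_mono) auto
  also have "\<dots> = (\<integral>\<^sup>+x. ennreal (\<nu> z) * (h x * ennreal (\<nu> x)) \<partial>M)"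
    by (rule nn_integral_left_translation[of "\<lambda>x. ennreal (\<nu> z) * (h x * ennreal (\<nu> x))" "- z"]) measurable
  also have "\<dots> = ennreal (\<nu> z) * (\<integral>\<^sup>+x. h x * ennreal (\<nu> x) \<partial>M)"
    by (intro nn_integral_cmult) measurable
  finally show ?thesis .
qed

text \<open>
  Let \<open>K\<close> be a compact set outside which \<open>G\<close> has a small integral, and \<open>V\<close> a compact neighbourhood of
  \<open>0\<close>.  Outside \<open>V + K\<close> neither \<open>x\<close> nor \<open>- z + x\<close> lies in \<open>K\<close> for \<open>z \<in> V\<close>, so both terms have small
  integrals there.  On the compact set \<open>V + K\<close> the integrand tends to \<open>0\<close> uniformly.
\<close>

lemma weighted_L1_translation_continuous_at_0:
  fixes G :: "'g \<Rightarrow> complex"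
  assumes cont: "continuous_on UNIV G"
    and int: "(\<integral>\<^sup>+x. ennreal (cmod (G x)) * ennreal (\<nu> x) \<partial>M) < \<infinity>" and e: "0 < e"
  shows "\<exists>W. open W \<and> 0 \<in> W \<and>
    (\<forall>z\<in>W. (\<integral>\<^sup>+x. ennreal (cmod (G (- z + x) - G x)) * ennreal (\<nu> x) \<partial>M) < ennreal e)"
proof -
  have Gb [measurable]: "G \<in> borel_measurable borel" using cont
    by (simp add: borel_measurable_continuous_onI)
  have [measurable]: "G \<in> borel_measurable M" using Gb by (simp cong: measurable_cong_sets)
  obtain W0 V :: "'g set" where WV: "open W0" "compact V" "0 \<in> W0" "W0 \<subseteq> V"
    using lc unfolding locally_compact_space_def
    by (metis UNIV_I compactin_euclidean_iff open_openin topspace_euclidean)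
  obtain C where C: "1 \<le> C" "\<And>z. z \<in> V \<Longrightarrow> \<nu> z \<le> C" using weight_bounded_on_compact[OF WV(2)] by blast
  obtain K where K: "compact K" "(\<integral>\<^sup>+x. ennreal (cmod (G x) * \<nu> x) * indicator (- K) x \<partial>M) < ennreal (e / (4 * C))"
  proof -
    have "continuous_on UNIV (\<lambda>x. cmod (G x) * \<nu> x)"
      by (intro continuous_intros cont weight_cont)
    then show ?thesis
      using compact_concentration[of "\<lambda>x. cmod (G x) * \<nu> x" "e / (4 * C)"] int e C(1) that
      by (auto simp: ennreal_mult)
  qed
  define K' where "K' = (\<lambda>p. fst p + snd p) ` (V \<times> K)"
  have K': "compact K'" unfolding K'_def by (intro compact_add WV K)
  have [measurable]: "K \<in> sets M" "K' \<in> sets M" "K \<in> sets borel" using compact_imp_closed[OF K(1)] compact_imp_closed[OF K'] by auto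
  obtain D where D: "1 \<le> D" "\<And>z. z \<in> K' \<Longrightarrow> \<nu> z \<le> D" using weight_bounded_on_compact[OF K'] by blast
  define m where "m = measure M K'"
  have m: "emeasure M K' = ennreal m" "0 \<le> m"
    using emeasure_compact[OF K'] by (auto simp: m_def emeasure_eq_ennreal_measure)
  \<comment> \<open>The constant is such that \<open>d * D * m \<le> e / 4\<close>; \<open>m + 1\<close> avoids division by \<open>0\<close>.\<close>
  define d where "d = e / (4 * D * (m + 1))"
  have d: "0 < d" using e D m by (simp add: d_def)
  define \<Delta> where "\<Delta> p = G (- fst p + snd p) - G (snd p)" for p
  have cont\<Delta>: "continuous_on (UNIV \<times> K') \<Delta>"
    unfolding \<Delta>_def by (intro continuous_intros continuous_on_compose2[OF cont]) auto
  obtain W1 where W1: "0 \<in> W1" "open W1"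
    "\<forall>z\<in>W1 \<inter> UNIV. \<forall>x\<in>K'. dist (\<Delta> (z, x)) (\<Delta> (0, x)) \<le> d"
    by (rule continuous_on_prod_compactE[OF cont\<Delta> K' UNIV_I[of 0] d])
  let ?t = "\<lambda>x. ennreal (cmod (G x)) * indicator (- K) x"
  show ?thesis
  proof (intro exI[of _ "W0 \<inter> W1"] conjI ballI)
    show "open (W0 \<inter> W1)" "0 \<in> W0 \<inter> W1" using WV W1 by auto
    fix z assume z: "z \<in> W0 \<inter> W1"
    have pw: "ennreal (cmod (G (- z + x) - G x)) * ennreal (\<nu> x) \<le>
      ennreal (d * D) * indicator K' x + (?t (- z + x) * ennreal (\<nu> x) + ?t x * ennreal (\<nu> x))" for x
    proof (cases "x \<in> K'")
      case True
      then have "cmod (G (- z + x) - G x) * \<nu> x \<le> d * D"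
        using W1(3) z D(2)[OF True] d by (intro mult_mono) (auto simp: dist_norm \<Delta>_def)
      then have "ennreal (cmod (G (- z + x) - G x)) * ennreal (\<nu> x) \<le> ennreal (d * D)"
        by (simp add: ennreal_mult[symmetric] ennreal_leI)
      then show ?thesis using True by (simp add: add_increasing2)
    next
      case False
      have xK: "x \<notin> K" using False WV unfolding K'_def by (force intro: image_eqI[of _ _ "(0,x)"])
      have zK: "- z + x \<notin> K"
      proof
        assume "- z + x \<in> K"
        then have "z + (- z + x) \<in> K'" using z WV unfolding K'_def
          by (force intro: image_eqI[of _ _ "(z,- z + x)"])
        then show False using False by (simp add: add.assoc[symmetric])
      qed
      have "ennreal (cmod (G (- z + x) - G x)) \<le> ennreal (cmod (G (- z + x))) + ennreal (cmod (G x))"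
        using norm_triangle_ineq4 by (simp add: ennreal_plus[symmetric] ennreal_leI del: ennreal_plus)
      then have "ennreal (cmod (G (- z + x) - G x)) * ennreal (\<nu> x)
          \<le> (ennreal (cmod (G (- z + x))) + ennreal (cmod (G x))) * ennreal (\<nu> x)"
        by (rule mult_right_mono) simp
      then show ?thesis using False xK zK by (simp add: distrib_right)
    qed
    have tail: "(\<integral>\<^sup>+x. ?t x * ennreal (\<nu> x) \<partial>M) \<le> ennreal (e / (4 * C))"
    proof -
      have "(\<integral>\<^sup>+x. ?t x * ennreal (\<nu> x) \<partial>M) = (\<integral>\<^sup>+x. ennreal (cmod (G x) * \<nu> x) * indicator (- K) x \<partial>M)"
        by (intro nn_integral_cong) (simp add: ennreal_mult ac_simps)
      then show ?thesis using K(2) by simp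
    qed
    have "(\<integral>\<^sup>+x. ennreal (cmod (G (- z + x) - G x)) * ennreal (\<nu> x) \<partial>M)
      \<le> (\<integral>\<^sup>+x. ennreal (d * D) * indicator K' x + (?t (- z + x) * ennreal (\<nu> x) + ?t x * ennreal (\<nu> x)) \<partial>M)"
      by (intro nn_integral_mono pw)
    also have "\<dots> = (\<integral>\<^sup>+x. ennreal (d * D) * indicator K' x \<partial>M)
      + ((\<integral>\<^sup>+x. ?t (- z + x) * ennreal (\<nu> x) \<partial>M) + (\<integral>\<^sup>+x. ?t x * ennreal (\<nu> x) \<partial>M))"
      by (subst nn_integral_add; (subst nn_integral_add)?) measurable
    also have "\<dots> \<le> ennreal (e/4) + (ennreal (e/4) + ennreal (e/4))"
    proof (intro add_mono)
      have "(\<integral>\<^sup>+x. ennreal (d * D) * indicator K' x \<partial>M) = ennreal (d * D) * ennreal m"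
        by (subst nn_integral_cmult_indicator) (auto simp: m compact_imp_closed[OF K'])
      also have "\<dots> = ennreal (d * D * m)" using d D m by (simp add: ennreal_mult)
      also have "\<dots> \<le> ennreal (e/4)"
      proof (rule ennreal_leI)
        have "d * D * m = e / 4 * (m / (m + 1))" using D m by (simp add: d_def divide_simps)
        also have "\<dots> \<le> e / 4" using m e by (intro mult_left_le) auto
        finally show "d * D * m \<le> e / 4" .
      qed
      finally show "(\<integral>\<^sup>+x. ennreal (d * D) * indicator K' x \<partial>M) \<le> ennreal (e/4)" .
      have "(\<integral>\<^sup>+x. ?t (- z + x) * ennreal (\<nu> x) \<partial>M) \<le> ennreal (\<nu> z) * (\<integral>\<^sup>+x. ?t x * ennreal (\<nu> x) \<partial>M)"
        by (rule weighted_integral_translation_le) measurable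
      also have "\<dots> \<le> ennreal C * ennreal (e / (4 * C))"
        using tail C z WV by (intro mult_mono ennreal_leI) auto
      also have "\<dots> = ennreal (e/4)" using C e by (simp add: ennreal_mult[symmetric])
      finally show "(\<integral>\<^sup>+x. ?t (- z + x) * ennreal (\<nu> x) \<partial>M) \<le> ennreal (e/4)" .
      have "e / (4 * C) \<le> e / 4" using C e by (intro divide_left_mono) auto
      then show "(\<integral>\<^sup>+x. ?t x * ennreal (\<nu> x) \<partial>M) \<le> ennreal (e/4)"
        using order_trans[OF tail ennreal_leI] by blast
    qed
    also have "\<dots> = ennreal (3/4 * e)" using e by (simp add: ennreal_plus[symmetric] del: ennreal_plus)
    also have "\<dots> < ennreal e" using e by (simp add: ennreal_less_iff)
    finally show "(\<integral>\<^sup>+x. ennreal (cmod (G (- z + x) - G x)) * ennreal (\<nu> x) \<partial>M) < ennreal e" .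
  qed
qed

end

section \<open>Test functions and distributions\<close>

text \<open>
  Polarization; it yields continuity of the inner product from that of the norm.
\<close>

lemma Re_cinner_eq:
  fixes x y :: "'h::complex_hilbert_space"
  shows "Re (cinner x y) = ((norm (x + y))\<^sup>2 - (norm (x - y))\<^sup>2) / 4"
proof -
  have sq: "(norm u)\<^sup>2 = Re (cinner u u)" for u :: 'h
  proof -
    have "0 \<le> sqrt (Re (cinner u u))" by (metis norm_eq_sqrt_cinner norm_ge_zero)
    then show ?thesis by (simp add: norm_eq_sqrt_cinner)
  qed
  have right: "cinner u (v + w) = cinner u v + cinner u w" for u v w :: 'h
    by (metis cinner_commute cinner_add_left complex_cnj_add)
  have scal: "cinner (- u) v = - cinner u v" for u v :: 'h
    using cinner_scaleC_left[of "- 1" u v] scaleC_of_real[of "- 1" u] by simp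
  have scal2: "cinner u (- v) = - cinner u v" for u v :: 'h
    by (metis cinner_commute scal complex_cnj_minus)
  have "Re (cinner y x) = Re (cinner x y)" by (subst cinner_commute) simp
  moreover have "cinner (x - y) (x - y) = cinner x x - cinner x y - (cinner y x - cinner y y)"
    by (simp only: diff_conv_add_uminus right cinner_add_left scal scal2) simp
  ultimately show ?thesis
    unfolding sq by (simp add: right cinner_add_left)
qed

lemma continuous_on_cinner_right:
  fixes x :: "'h::complex_hilbert_space"
  assumes "continuous_on A f"
  shows "continuous_on A (\<lambda>z. cinner x (f z))"
proof -
  \<comment> \<open>Complex linearity in the first argument reduces the imaginary part to a real part.\<close>
  have "Im c = Re (- \<i> * c)" for c by simp
  then have "Im (cinner x y) = Re (cinner ((- \<i>) *\<^sub>C x) y)" for y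
    by (simp only: cinner_scaleC_left)
  then have eq: "(\<lambda>z. cinner x (f z)) =
    (\<lambda>z. Complex (Re (cinner x (f z))) (Re (cinner ((- \<i>) *\<^sub>C x) (f z))))"
    by (auto simp: complex_eq_iff)
  show ?thesis
    unfolding eq unfolding Complex_eq Re_cinner_eq by (intro continuous_intros assms) simp_all
qed

lemma cinner_diff_left: "cinner (x - y) z = cinner x z - cinner (y::'h::complex_hilbert_space) z"
  using cinner_add_left[of "x - y" y z] by simp

locale test_functions = weighted_group M \<nu>
  for M :: "'g::{topological_group_add,t2_space} measure" and \<nu> +
  fixes \<pi> :: "'g \<Rightarrow> 'h::complex_hilbert_space \<Rightarrow> 'h" and g0 :: 'h
  assumes unitary: "unitary_representation \<pi>" and cont_rep: "strongly_continuous \<pi>"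
begin

abbreviation "\<A> \<equiv> test_space M \<nu> \<pi> g0"
abbreviation "\<A>_norm \<equiv> test_norm M \<nu> \<pi> g0"
abbreviation "\<D> \<equiv> distribution_space M \<nu> \<pi> g0"
abbreviation "\<D>_norm \<equiv> distribution_norm M \<nu> \<pi> g0"
abbreviation "rcoeff \<equiv> rep_coefficient \<pi> g0"

lemma continuous_coeff: "continuous_on UNIV (rcoeff h)"
proof -
  have "continuous_on UNIV (\<lambda>z. cinner h (\<pi> z g0))"
    using cont_rep unfolding strongly_continuous_def by (intro continuous_on_cinner_right) auto
  then show ?thesis by (simp add: rep_coefficient_def)
qed

lemma measurable_coeff [measurable]: "rcoeff h \<in> borel_measurable borel" "rcoeff h \<in> borel_measurable M"
proof -
  show "rcoeff h \<in> borel_measurable borel" by (intro borel_measurable_continuous_onI continuous_coeff)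
  then show "rcoeff h \<in> borel_measurable M" by (simp cong: measurable_cong_sets)
qed

lemma coeff_translate: "rcoeff (\<pi> z h) x = rcoeff h (- z + x)"
proof -
  have "cinner h (\<pi> (- z + x) g0) = cinner (\<pi> z h) (\<pi> z (\<pi> (- z + x) g0))"
    using unitary by (simp add: unitary_representation_def)
  also have "\<pi> z (\<pi> (- z + x) g0) = \<pi> (z + (- z + x)) g0"
    using unitary unfolding unitary_representation_def by metis
  finally show ?thesis by (simp add: rep_coefficient_def add.assoc[symmetric])
qed

lemma coeff_diff: "rcoeff (h - k) x = rcoeff h x - rcoeff k x"
  by (simp add: rep_coefficient_def cinner_diff_left)

text \<open>
  The continuity of the coefficients settles measurability, so that only finiteness of an integral
  over \<^typ>\<open>ennreal\<close> remains.
\<close>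

lemma test_space_iff: "h \<in> \<A> \<longleftrightarrow> (\<integral>\<^sup>+x. ennreal (cmod (rcoeff h x)) * ennreal (\<nu> x) \<partial>M) < \<infinity>"
  by (simp add: test_space_def weighted_L1_def integrable_iff_bounded ennreal_mult norm_mult)

lemma test_norm_eq: "h \<in> \<A> \<Longrightarrow> ennreal (\<A>_norm h) = (\<integral>\<^sup>+x. ennreal (cmod (rcoeff h x)) * ennreal (\<nu> x) \<partial>M)"
  unfolding test_norm_def weighted_L1_norm_def
  by (subst nn_integral_eq_integral[symmetric])
     (auto simp: test_space_def weighted_L1_def ennreal_mult)

lemma test_norm_nonneg: "0 \<le> \<A>_norm h"
  unfolding test_norm_def weighted_L1_norm_def by (intro integral_nonneg_AE) auto

lemma test_space_diff:
  assumes "h \<in> \<A>" "k \<in> \<A>"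
  shows "h - k \<in> \<A>"
proof -
  have "integrable M (\<lambda>x. cmod (rcoeff h x) * \<nu> x + cmod (rcoeff k x) * \<nu> x)"
    using assms by (intro Bochner_Integration.integrable_add) (auto simp: test_space_def weighted_L1_def)
  then have "integrable M (\<lambda>x. cmod (rcoeff h x - rcoeff k x) * \<nu> x)"
  proof (rule Bochner_Integration.integrable_bound)
    show "AE x in M. norm (cmod (rcoeff h x - rcoeff k x) * \<nu> x)
        \<le> norm (cmod (rcoeff h x) * \<nu> x + cmod (rcoeff k x) * \<nu> x)"
    proof (intro AE_I2)
      fix x
      have "cmod (rcoeff h x - rcoeff k x) * \<nu> x \<le> (cmod (rcoeff h x) + cmod (rcoeff k x)) * \<nu> x"
        by (intro mult_right_mono norm_triangle_ineq4) simp
      then show "norm (cmod (rcoeff h x - rcoeff k x) * \<nu> x)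
        \<le> norm (cmod (rcoeff h x) * \<nu> x + cmod (rcoeff k x) * \<nu> x)"
        by (simp add: norm_mult distrib_right)
    qed
  qed measurable
  then show ?thesis by (simp add: test_space_def weighted_L1_def coeff_diff)
qed

lemma test_space_translate:
  assumes "h \<in> \<A>"
  shows "\<pi> z h \<in> \<A>"
proof -
  have "(\<integral>\<^sup>+x. ennreal (cmod (rcoeff (\<pi> z h) x)) * ennreal (\<nu> x) \<partial>M)
      \<le> ennreal (\<nu> z) * (\<integral>\<^sup>+x. ennreal (cmod (rcoeff h x)) * ennreal (\<nu> x) \<partial>M)"
    unfolding coeff_translate
    by (rule weighted_integral_translation_le[of "\<lambda>x. ennreal (cmod (rcoeff h x))"]) measurable
  also have "\<dots> < \<infinity>" using assms by (simp add: test_space_iff ennreal_mult_less_top)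
  finally show ?thesis by (simp add: test_space_iff)
qed

text \<open>
  Invariance moves the point \<open>z\<close> to \<open>0\<close> at the cost of the factor \<open>\<nu> z\<close>; at \<open>0\<close> this is the continuity
  of translations in weighted \<open>L\<^sup>1\<close> for the coefficient of \<open>h\<close>.
\<close>

lemma test_norm_orbit_continuous:
  assumes h: "h \<in> \<A>" and e: "0 < e"
  shows "\<exists>W. open W \<and> z \<in> W \<and> (\<forall>w\<in>W. \<A>_norm (\<pi> w h - \<pi> z h) < e)"
proof -
  obtain W where W: "open W" "0 \<in> W"
    "\<And>w. w \<in> W \<Longrightarrow> (\<integral>\<^sup>+x. ennreal (cmod (rcoeff h (- w + x) - rcoeff h x)) * ennreal (\<nu> x) \<partial>M) < ennreal (e / \<nu> z)"
    using weighted_L1_translation_continuous_at_0[OF continuous_coeff, of h "e / \<nu> z"] h e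
    by (auto simp: test_space_iff)
  show ?thesis
  proof (intro exI[of _ "{w. - z + w \<in> W}"] conjI ballI)
    show "open {w. - z + w \<in> W}" by (rule open_left_coset[OF W(1)])
    show "z \<in> {w. - z + w \<in> W}" using W(2) by simp
    fix w assume w: "w \<in> {w. - z + w \<in> W}"
    let ?f = "\<lambda>x. ennreal (cmod (rcoeff h (- (- z + w) + x) - rcoeff h x))"
    have "ennreal (\<A>_norm (\<pi> w h - \<pi> z h)) = (\<integral>\<^sup>+x. ?f (- z + x) * ennreal (\<nu> x) \<partial>M)"
    proof (subst test_norm_eq[OF test_space_diff[OF test_space_translate[OF h] test_space_translate[OF h]]],
        intro nn_integral_cong)
      fix x
      have "- (- z + w) + (- z + x) = - w + x"
        by (simp add: minus_add add.assoc[symmetric])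
      then show "ennreal (cmod (rcoeff (\<pi> w h - \<pi> z h) x)) * ennreal (\<nu> x) = ?f (- z + x) * ennreal (\<nu> x)"
        by (simp add: coeff_diff coeff_translate)
    qed
    also have "\<dots> \<le> ennreal (\<nu> z) * (\<integral>\<^sup>+x. ?f x * ennreal (\<nu> x) \<partial>M)"
    proof (rule weighted_integral_translation_le)
      show "?f \<in> borel_measurable borel"
        by (intro borel_measurable_continuous_onI continuous_on_ennreal continuous_intros
            continuous_on_compose2[OF continuous_coeff] continuous_coeff) auto
    qed
    also have "\<dots> < ennreal (\<nu> z) * ennreal (e / \<nu> z)"
      using W(3)[of "- z + w"] w by (intro ennreal_mult_strict_left_mono) auto
    also have "\<dots> = ennreal e" using e by (simp add: ennreal_mult[symmetric] less_imp_neq[THEN not_sym])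
    finally show "\<A>_norm (\<pi> w h - \<pi> z h) < e" using e by (simp add: ennreal_less_iff test_norm_nonneg)
  qed
qed

lemma test_norm_scaleC: "\<A>_norm (c *\<^sub>C h) = cmod c * \<A>_norm h"
  and test_space_scaleC: "h \<in> \<A> \<Longrightarrow> c *\<^sub>C h \<in> \<A>"
proof -
  have "rcoeff (c *\<^sub>C h) = (\<lambda>z. c * rcoeff h z)" for c h
    by (auto simp: rep_coefficient_def cinner_scaleC_left)
  then show "\<A>_norm (c *\<^sub>C h) = cmod c * \<A>_norm h" "h \<in> \<A> \<Longrightarrow> c *\<^sub>C h \<in> \<A>"
    by (auto simp: test_norm_def weighted_L1_norm_def test_space_def weighted_L1_def norm_mult mult.assoc)
qed

text \<open>
  Homogeneity reduces the claim to vectors of norm one.  Vectors of norm zero are handled by the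
  boundedness of \<open>f\<close>, which forces \<open>f h = 0\<close>.
\<close>

lemma distribution_bound:
  assumes f: "f \<in> \<D>" and h: "h \<in> \<A>"
  shows "cmod (f h) \<le> \<D>_norm f * \<A>_norm h"
proof -
  obtain B where B: "\<And>h. h \<in> \<A> \<Longrightarrow> cmod (f h) \<le> B * \<A>_norm h"
    using f unfolding distribution_space_def by blast
  have "bdd_above ((\<lambda>h. cmod (f h)) ` {h \<in> \<A>. \<A>_norm h \<le> 1})"
  proof (rule bdd_aboveI2)
    fix h assume h: "h \<in> {h \<in> \<A>. \<A>_norm h \<le> 1}"
    then have "cmod (f h) \<le> B * \<A>_norm h" using B by auto
    also have "\<dots> \<le> \<bar>B\<bar> * 1" using h test_norm_nonneg[of h] by (intro mult_mono) auto
    finally show "cmod (f h) \<le> \<bar>B\<bar>" by simp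
  qed
  then have unit: "cmod (f k) \<le> \<D>_norm f" if "k \<in> \<A>" "\<A>_norm k \<le> 1" for k
    unfolding distribution_norm_def using that by (intro cSUP_upper) auto
  show ?thesis
  proof (cases "\<A>_norm h = 0")
    case True
    then show ?thesis using B[OF h] by simp
  next
    case False
    then have pos: "0 < \<A>_norm h" using test_norm_nonneg[of h] by simp
    let ?c = "complex_of_real (1 / \<A>_norm h)"
    have "cmod (f (?c *\<^sub>C h)) \<le> \<D>_norm f"
      using pos by (intro unit test_space_scaleC h) (simp add: test_norm_scaleC norm_divide)
    moreover have "f (?c *\<^sub>C h) = cnj ?c * f h" using f h by (simp add: distribution_space_def)
    ultimately have "cmod (f h) / \<A>_norm h \<le> \<D>_norm f" using pos by (simp add: norm_mult norm_divide)
    then show ?thesis using pos by (simp add: divide_simps)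
  qed
qed

lemma distribution_diff_arg:
  assumes f: "f \<in> \<D>" and "h \<in> \<A>" "k \<in> \<A>"
  shows "f (h - k) = f h - f k"
proof -
  have "f ((h - k) + k) = f (h - k) + f k"
    using assms test_space_diff unfolding distribution_space_def by blast
  then show ?thesis by simp
qed

lemma distribution_diff:
  assumes "f1 \<in> \<D>" "f2 \<in> \<D>"
  shows "(\<lambda>h. f1 h - f2 h) \<in> \<D>"
proof -
  have "cmod (f1 h - f2 h) \<le> (\<D>_norm f1 + \<D>_norm f2) * \<A>_norm h" if "h \<in> \<A>" for h
    using distribution_bound[OF assms(1) that] distribution_bound[OF assms(2) that]
      norm_triangle_ineq4[of "f1 h" "f2 h"] by (simp add: distrib_right)
  then have "\<exists>B. \<forall>h\<in>\<A>. cmod (f1 h - f2 h) \<le> B * \<A>_norm h" by blast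
  then show ?thesis using assms
    by (simp add: distribution_space_def right_diff_distrib)
qed

lemma voice_transform_diff:
  "voice_transform \<pi> g (\<lambda>h. f1 h - f2 h) = (\<lambda>z. voice_transform \<pi> g f1 z - voice_transform \<pi> g f2 z)"
  by (rule ext) (simp add: voice_transform_def)

lemma voice_transform_bound:
  "f \<in> \<D> \<Longrightarrow> g \<in> \<A> \<Longrightarrow> cmod (voice_transform \<pi> g f z) \<le> \<D>_norm f * \<A>_norm (\<pi> z g)"
  unfolding voice_transform_def by (intro distribution_bound test_space_translate)

lemma voice_transform_modulus:
  assumes "f \<in> \<D>" "g \<in> \<A>"
  shows "cmod (voice_transform \<pi> g f w - voice_transform \<pi> g f z) \<le> \<D>_norm f * \<A>_norm (\<pi> w g - \<pi> z g)"
  unfolding voice_transform_def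
  using distribution_bound[OF assms(1) test_space_diff] assms test_space_translate
  by (simp flip: distribution_diff_arg)

text \<open>
  The modulus of continuity is that of the orbit of \<open>g\<close> times the norm of \<open>f\<close>, hence uniform on norm
  balls of distributions.
\<close>

lemma voice_transform_equicontinuous:
  assumes g: "g \<in> \<A>" and e: "0 < e"
  shows "\<exists>W. open W \<and> z \<in> W \<and> (\<forall>w\<in>W. \<forall>f\<in>{f \<in> \<D>. \<D>_norm f \<le> R}.
    cmod (voice_transform \<pi> g f w - voice_transform \<pi> g f z) < e)"
proof -
  \<comment> \<open>A positive bound for the norms, whatever the sign of \<open>R\<close>.\<close>
  let ?R = "\<bar>R\<bar> + 1"
  obtain W where W: "open W" "z \<in> W" "\<And>w. w \<in> W \<Longrightarrow> \<A>_norm (\<pi> w g - \<pi> z g) < e / ?R"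
  proof -
    have "0 < e / ?R" using e by (intro divide_pos_pos) auto
    then show ?thesis using test_norm_orbit_continuous[OF g, of "e / ?R" z] that by blast
  qed
  show ?thesis
  proof (intro exI[of _ W] conjI ballI W)
    fix w f assume w: "w \<in> W" and f: "f \<in> {f \<in> \<D>. \<D>_norm f \<le> R}"
    have "cmod (voice_transform \<pi> g f w - voice_transform \<pi> g f z) \<le> \<D>_norm f * \<A>_norm (\<pi> w g - \<pi> z g)"
      using f by (intro voice_transform_modulus g) auto
    also have "\<dots> \<le> ?R * \<A>_norm (\<pi> w g - \<pi> z g)"
      using f by (intro mult_right_mono test_norm_nonneg) auto
    also have "\<dots> < ?R * (e / ?R)" using W(3)[OF w] by (intro mult_strict_left_mono) auto
    finally show "cmod (voice_transform \<pi> g f w - voice_transform \<pi> g f z) < e" by simp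
  qed
qed

lemma continuous_voice_transform:
  assumes "f \<in> \<D>" "g \<in> \<A>"
  shows "continuous_on UNIV (voice_transform \<pi> g f)"
  unfolding continuous_on_topological
proof (intro ballI allI impI)
  fix z B assume B: "open B" "voice_transform \<pi> g f z \<in> B"
  obtain e where e: "0 < e" "ball (voice_transform \<pi> g f z) e \<subseteq> B"
    using B open_contains_ball by blast
  obtain W where "open W" "z \<in> W" "\<forall>w\<in>W. cmod (voice_transform \<pi> g f w - voice_transform \<pi> g f z) < e"
    using voice_transform_equicontinuous[OF assms(2) e(1), of z "\<D>_norm f"] assms(1) by blast
  then show "\<exists>A. open A \<and> z \<in> A \<and> (\<forall>y\<in>UNIV. y \<in> A \<longrightarrow> voice_transform \<pi> g f y \<in> B)"
    using e(2) by (intro exI[of _ W]) (auto simp: dist_norm norm_minus_commute subset_iff)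
qed

end

section \<open>Solid function spaces with absolutely continuous norm\<close>

locale function_space = haar_measure M
  for M :: "'g::{topological_group_add,t2_space} measure" +
  fixes Y :: "('g \<Rightarrow> complex) set" and nY :: "('g \<Rightarrow> complex) \<Rightarrow> real"
  assumes bfs: "banach_function_space M Y nY" and solid: "solid M Y nY"
begin

lemma Y_measurable: "F \<in> Y \<Longrightarrow> F \<in> borel_measurable M"
  using bfs unfolding banach_function_space_def by blast

lemma Y_zero: "(\<lambda>x. 0) \<in> Y"
  using bfs unfolding banach_function_space_def by blast

lemma Y_add: "F \<in> Y \<Longrightarrow> G \<in> Y \<Longrightarrow> (\<lambda>x. F x + G x) \<in> Y"
  and nY_triangle: "F \<in> Y \<Longrightarrow> G \<in> Y \<Longrightarrow> nY (\<lambda>x. F x + G x) \<le> nY F + nY G"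
  using bfs unfolding banach_function_space_def by blast+

lemma Y_mult: "F \<in> Y \<Longrightarrow> (\<lambda>x. c * F x) \<in> Y"
  and nY_mult: "F \<in> Y \<Longrightarrow> nY (\<lambda>x. c * F x) = cmod c * nY F"
  using bfs unfolding banach_function_space_def by blast+

lemma nY_nonneg: "F \<in> Y \<Longrightarrow> 0 \<le> nY F"
  and nY_eq_0_iff: "F \<in> Y \<Longrightarrow> nY F = 0 \<longleftrightarrow> (AE x in M. F x = 0)"
  using bfs unfolding banach_function_space_def by blast+

lemma Y_diff: "F \<in> Y \<Longrightarrow> G \<in> Y \<Longrightarrow> (\<lambda>x. F x - G x) \<in> Y"
  and nY_triangle_diff: "F \<in> Y \<Longrightarrow> G \<in> Y \<Longrightarrow> nY (\<lambda>x. F x - G x) \<le> nY F + nY G"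
  using Y_add[of F "\<lambda>x. - 1 * G x"] nY_triangle[of F "\<lambda>x. - 1 * G x"] Y_mult[of G "- 1"]
    nY_mult[of G "- 1"] by simp_all

lemma Y_sum: "finite I \<Longrightarrow> (\<And>i. i \<in> I \<Longrightarrow> F i \<in> Y) \<Longrightarrow> (\<lambda>x. \<Sum>i\<in>I. F i x) \<in> Y"
  by (induction I rule: finite_induct) (auto intro: Y_zero Y_add)

lemma Y_solid:
  assumes "F \<in> Y" "G \<in> borel_measurable M" "AE z in M. cmod (G z) \<le> cmod (F z)"
  shows "G \<in> Y" "nY G \<le> nY F"
  using solid assms unfolding solid_def by blast+

lemma Y_restrict:
  assumes F: "F \<in> Y" and E: "E \<in> sets M"
  shows "(\<lambda>z. indicator E z * F z) \<in> Y" "nY (\<lambda>z. indicator E z * F z) \<le> nY F"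
proof -
  have "(\<lambda>z. indicator E z * F z) \<in> borel_measurable M"
    using E Y_measurable[OF F] by measurable
  moreover have "AE z in M. cmod (indicator E z * F z) \<le> cmod (F z)"
    by (intro AE_I2) (simp add: indicator_def)
  ultimately show "(\<lambda>z. indicator E z * F z) \<in> Y" "nY (\<lambda>z. indicator E z * F z) \<le> nY F"
    using Y_solid[OF F] by blast+
qed

lemma nY_restrict_mono:
  assumes F: "F \<in> Y" and E: "E \<in> sets M" "E' \<in> sets M" and sub: "E \<subseteq> E'"
  shows "nY (\<lambda>z. indicator E z * F z) \<le> nY (\<lambda>z. indicator E' z * F z)"
proof (rule Y_solid(2)[OF Y_restrict(1)[OF F E(2)] Y_measurable[OF Y_restrict(1)[OF F E(1)]]])
  show "AE z in M. cmod (indicator E z * F z) \<le> cmod (indicator E' z * F z)"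
    using sub by (intro AE_I2) (auto simp: indicator_def)
qed

text \<open>
  A limit in the norm of a solid space agrees almost everywhere with a pointwise limit: on the set where
  \<open>F n\<close> stays at distance at least \<open>1 / (k + 1)\<close> from \<open>H\<close> for all \<open>n \<ge> k\<close>, solidity bounds the norm
  of the indicator by a multiple of a null sequence, so this set is null.  These sets cover \<open>{G \<noteq> H}\<close>.
\<close>

lemma pointwise_limit_in_Y:
  assumes F: "\<And>n. F n \<in> Y" and H: "H \<in> Y"
    and lim: "(\<lambda>n. nY (\<lambda>x. F n x - H x)) \<longlonglongrightarrow> 0"
    and ptw: "\<And>z. (\<lambda>n. F n z) \<longlonglongrightarrow> G z"
  shows "G \<in> Y" "(\<lambda>n. nY (\<lambda>x. F n x - G x)) \<longlonglongrightarrow> 0"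
proof -
  have [measurable]: "F n \<in> borel_measurable M" "H \<in> borel_measurable M" for n
    using F H Y_measurable by auto
  have [measurable]: "G \<in> borel_measurable M" by (rule borel_measurable_LIMSEQ_metric[OF _ ptw]) measurable
  define A where "A k = {z \<in> space M. \<forall>n\<ge>k. inverse (real (Suc k)) \<le> cmod (F n z - H z)}" for k
  have [measurable]: "A k \<in> sets M" for k unfolding A_def by measurable
  have "AE z in M. z \<notin> A k" for k
  proof -
    define c where "c = complex_of_real (inverse (real (Suc k)))"
    define \<psi> where "\<psi> z = c * indicator (A k) z" for z
    have [measurable]: "\<psi> \<in> borel_measurable M" unfolding \<psi>_def by measurable
    have le: "AE z in M. cmod (\<psi> z) \<le> cmod (F n z - H z)" if "k \<le> n" for n
      using that by (intro AE_I2) (auto simp: \<psi>_def c_def A_def indicator_def norm_inverse norm_of_real simp del: of_nat_Suc)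
    have \<psi>: "\<psi> \<in> Y" by (rule Y_solid(1)[OF Y_diff[OF F H] _ le[OF order_refl]]) measurable
    have "nY \<psi> \<le> 0"
    proof (rule tendsto_lowerbound[OF lim])
      show "\<forall>\<^sub>F n in sequentially. nY \<psi> \<le> nY (\<lambda>x. F n x - H x)"
        unfolding eventually_sequentially
        by (intro exI[of _ k] allI impI Y_solid(2)[OF Y_diff[OF F H] _ le]) auto
    qed simp
    then have "nY \<psi> = 0" using nY_nonneg[OF \<psi>] by simp
    then have "AE z in M. \<psi> z = 0" using nY_eq_0_iff[OF \<psi>] by simp
    then show ?thesis
      by eventually_elim (auto simp: \<psi>_def c_def indicator_def simp del: of_nat_Suc split: if_splits)
  qed
  then have "AE z in M. \<forall>k. z \<notin> A k" by (simp add: AE_all_countable)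
  then have eq: "AE z in M. G z = H z"
  proof eventually_elim
    case (elim z)
    show ?case
    proof (rule ccontr)
      assume "G z \<noteq> H z"
      then have pos: "0 < cmod (G z - H z)" by simp
      have tl: "(\<lambda>n. cmod (F n z - H z)) \<longlonglongrightarrow> cmod (G z - H z)"
        by (intro tendsto_intros ptw)
      have "eventually (\<lambda>n. cmod (G z - H z) / 2 < cmod (F n z - H z)) sequentially"
        using pos by (intro order_tendstoD(1)[OF tl]) simp
      then obtain N where N: "\<And>n. N \<le> n \<Longrightarrow> cmod (G z - H z) / 2 < cmod (F n z - H z)"
        by (auto simp: eventually_sequentially)
      have "eventually (\<lambda>n. inverse (real (Suc n)) < cmod (G z - H z) / 2) sequentially"
        using pos by (intro order_tendstoD(2)[OF LIMSEQ_inverse_real_of_nat]) simp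
      then obtain N' where N': "\<And>n. N' \<le> n \<Longrightarrow> inverse (real (Suc n)) < cmod (G z - H z) / 2"
        by (auto simp: eventually_sequentially)
      have "z \<in> A (max N N')"
        unfolding A_def
      proof (simp del: of_nat_Suc, intro allI impI)
        fix n assume "N \<le> n \<and> N' \<le> n"
        then show "inverse (real (Suc (max N N'))) \<le> cmod (F n z - H z)"
          using N[of n] N'[of "max N N'"] by linarith
      qed
      then show False using elim by blast
    qed
  qed
  show G: "G \<in> Y" by (rule Y_solid(1)[OF H]) (use eq in \<open>auto elim: eventually_mono\<close>)
  have "nY (\<lambda>x. F n x - G x) \<le> nY (\<lambda>x. F n x - H x)" for n
    by (rule Y_solid(2)[OF Y_diff[OF F H] Y_measurable[OF Y_diff[OF F G]]])
       (use eq in \<open>auto elim: eventually_mono\<close>)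
  then show "(\<lambda>n. nY (\<lambda>x. F n x - G x)) \<longlonglongrightarrow> 0"
    using nY_nonneg[OF Y_diff[OF F G]] by (intro tendsto_sandwich[OF _ _ tendsto_const lim]) auto
qed

lemma Y_complete:
  assumes "\<And>n. F n \<in> Y" "\<And>e. 0 < e \<Longrightarrow> \<exists>N. \<forall>m\<ge>N. \<forall>n\<ge>N. nY (\<lambda>x. F m x - F n x) < e"
  shows "\<exists>G\<in>Y. (\<lambda>n. nY (\<lambda>x. F n x - G x)) \<longlonglongrightarrow> 0"
  using bfs assms unfolding banach_function_space_def by simp

text \<open>
  Solidity puts the indicator of the nonempty open set \<open>W = {\<bar>F\<bar> > \<bar>F a\<bar> / 2}\<close> into \<open>Y\<close>, and \<open>U\<close> is covered
  by finitely many translates of \<open>W\<close>.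
\<close>

lemma indicator_compact_in_Y:
  assumes ti: "translation_invariant Y"
    and F: "F \<in> Y" "continuous_on UNIV F" "F a \<noteq> 0" and U: "compact U"
  shows "(\<lambda>z. indicator U z) \<in> Y"
proof -
  define W where "W = {z. cmod (F a) / 2 < cmod (F z)}"
  have W: "open W" "a \<in> W"
    unfolding W_def using F by (auto intro!: open_Collect_less continuous_intros)
  define \<psi> :: "'g \<Rightarrow> complex" where "\<psi> = indicator W"
  have \<psi>: "\<psi> \<in> Y"
  proof (rule Y_solid(1)[OF Y_mult[OF F(1), of "complex_of_real (2 / cmod (F a))"]])
    show "\<psi> \<in> borel_measurable M" unfolding \<psi>_def using W(1) by (intro borel_measurable_indicator) simp
    show "AE z in M. cmod (\<psi> z) \<le> cmod (complex_of_real (2 / cmod (F a)) * F z)"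
      using F(3) by (intro AE_I2) (auto simp: \<psi>_def W_def indicator_def norm_mult norm_divide field_simps)
  qed
  \<comment> \<open>The translate of \<open>W\<close> that moves \<open>a \<in> W\<close> to \<open>b\<close>.\<close>
  let ?T = "\<lambda>b. {x. - (b - a) + x \<in> W}"
  have bT: "b \<in> ?T b" for b using W(2) by simp
  obtain Z where Z: "Z \<subseteq> U" "finite Z" "U \<subseteq> (\<Union>b\<in>Z. ?T b)"
  proof (rule compactE_image[OF U, of U ?T])
    show "open (?T b)" for b by (rule open_left_coset[OF W(1)])
    show "U \<subseteq> (\<Union>b\<in>U. ?T b)" using bT by blast
  qed
  have "(\<lambda>x. \<psi> (- (b - a) + x)) \<in> Y" for b
    using ti \<psi> unfolding translation_invariant_def by blast
  then have sumY: "(\<lambda>x. \<Sum>b\<in>Z. \<psi> (- (b - a) + x)) \<in> Y" by (intro Y_sum Z)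
  show ?thesis
  proof (rule Y_solid(1)[OF sumY])
    show "(\<lambda>z. indicator U z :: complex) \<in> borel_measurable M"
      using compact_imp_closed[OF U] by (intro borel_measurable_indicator) simp
    have "cmod (indicator U z) \<le> cmod (\<Sum>b\<in>Z. \<psi> (- (b - a) + z))" for z
    proof (cases "z \<in> U")
      case True
      then obtain b where b: "b \<in> Z" "- (b - a) + z \<in> W" using Z(3) by blast
      have "(1::real) = indicator W (- (b - a) + z)" using b by simp
      also have "\<dots> \<le> (\<Sum>b\<in>Z. indicator W (- (b - a) + z))"
        by (intro member_le_sum b Z) auto
      also have "\<dots> \<le> cmod (complex_of_real (\<Sum>b\<in>Z. indicator W (- (b - a) + z)))"
        unfolding norm_of_real by simp
      also have "complex_of_real (\<Sum>b\<in>Z. indicator W (- (b - a) + z)) = (\<Sum>b\<in>Z. \<psi> (- (b - a) + z))"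
        unfolding of_real_sum by (intro sum.cong) (auto simp: \<psi>_def indicator_def)
      finally show ?thesis using True by simp
    qed simp
    then show "AE z in M. cmod (indicator U z) \<le> cmod (\<Sum>b\<in>Z. \<psi> (- (b - a) + z))" by simp
  qed
qed

lemma nY_restrict_le_sup:
  assumes U: "compact U" "(\<lambda>z. indicator U z) \<in> Y"
    and F: "F \<in> Y" "\<And>z. z \<in> U \<Longrightarrow> cmod (F z) \<le> \<delta>" and \<delta>: "0 \<le> \<delta>"
  shows "nY (\<lambda>z. indicator U z * F z) \<le> \<delta> * nY (indicator U)"
proof -
  have "nY (\<lambda>z. indicator U z * F z) \<le> nY (\<lambda>z. complex_of_real \<delta> * indicator U z)"
  proof (rule Y_solid(2)[OF Y_mult[OF U(2)]])
    show "(\<lambda>z. indicator U z * F z) \<in> borel_measurable M"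
      using compact_imp_closed[OF U(1)] by (intro Y_measurable Y_restrict F) simp
    show "AE z in M. cmod (indicator U z * F z) \<le> cmod (complex_of_real \<delta> * indicator U z)"
      using F(2) \<delta> by (intro AE_I2) (auto simp: indicator_def)
  qed
  also have "\<dots> = \<delta> * nY (indicator U)" using nY_mult[OF U(2), of "complex_of_real \<delta>"] \<delta> by simp
  finally show ?thesis .
qed

end

locale absolutely_continuous_space = function_space +
  assumes acn: "absolutely_continuous_norm M Y nY"
begin

lemma vanishing_restrictions:
  assumes "F \<in> Y" "\<And>n. E n \<in> sets M" "\<And>z. \<forall>\<^sub>F n in sequentially. z \<notin> E n"
  shows "(\<lambda>n. nY (\<lambda>z. indicator (E n) z * F z)) \<longlonglongrightarrow> 0"
proof -
  have "(\<lambda>n. indicator (E n) z :: real) \<longlonglongrightarrow> 0" for z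
    by (rule tendsto_eventually) (use assms(3)[of z] in \<open>auto elim: eventually_mono\<close>)
  then show ?thesis using acn assms(1,2) unfolding absolutely_continuous_norm_def by simp
qed

text \<open>
  Only finitely many pieces can carry norm at least \<open>1 / (k + 1)\<close>: a sequence of distinct disjoint
  pieces tends to the empty set, so the norms on them tend to \<open>0\<close>.
\<close>

lemma countably_many_pieces:
  assumes F: "F \<in> Y" and disj: "disjoint \<C>" and sets: "\<C> \<subseteq> sets M"
  shows "countable {C \<in> \<C>. nY (\<lambda>z. indicator C z * F z) \<noteq> 0}"
proof -
  define \<D> where "\<D> k = {C \<in> \<C>. inverse (real (Suc k)) \<le> nY (\<lambda>z. indicator C z * F z)}" for k
  have "finite (\<D> k)" for k
  proof (rule ccontr)
    assume "infinite (\<D> k)"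
    then obtain c :: "nat \<Rightarrow> 'a set" where c: "inj c" "range c \<subseteq> \<D> k"
      using infinite_countable_subset by blast
    have cC: "c n \<in> \<C>" for n using c(2) by (auto simp: \<D>_def)
    have "\<forall>\<^sub>F n in sequentially. z \<notin> c n" for z
    proof (cases "\<exists>m. z \<in> c m")
      case True
      then obtain m where m: "z \<in> c m" by blast
      have "z \<notin> c n" if "n > m" for n
      proof -
        have "c n \<noteq> c m" using c(1) that by (auto dest: injD)
        then have "c n \<inter> c m = {}" using disj cC unfolding disjoint_def by blast
        then show ?thesis using m by blast
      qed
      then show ?thesis by (auto simp: eventually_sequentially intro!: exI[of _ "Suc m"])
    qed simp
    then have "(\<lambda>n. nY (\<lambda>z. indicator (c n) z * F z)) \<longlonglongrightarrow> 0"
      using cC sets by (intro vanishing_restrictions F) auto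
    moreover have "inverse (real (Suc k)) \<le> nY (\<lambda>z. indicator (c n) z * F z)" for n
      using c(2) by (auto simp: \<D>_def)
    ultimately have "inverse (real (Suc k)) \<le> 0"
      by (intro tendsto_lowerbound[of _ 0]) auto
    then show False by simp
  qed
  then have "countable (\<Union>k. \<D> k)" by (auto intro: countable_finite)
  moreover have "{C \<in> \<C>. nY (\<lambda>z. indicator C z * F z) \<noteq> 0} \<subseteq> (\<Union>k. \<D> k)"
  proof
    fix C assume C: "C \<in> {C \<in> \<C>. nY (\<lambda>z. indicator C z * F z) \<noteq> 0}"
    then have "0 < nY (\<lambda>z. indicator C z * F z)"
      using nY_nonneg[OF Y_restrict(1)[OF F, of C]] sets by auto
    then obtain k where "inverse (real (Suc k)) < nY (\<lambda>z. indicator C z * F z)"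
      using reals_Archimedean by blast
    then show "C \<in> (\<Union>k. \<D> k)" using C by (auto simp: \<D>_def intro!: exI[of _ k])
  qed
  ultimately show ?thesis by (rule countable_subset[rotated])
qed

text \<open>
  All but countably many cosets carry norm zero, and there \<open>F\<close> vanishes almost everywhere, hence
  everywhere by continuity.  Vanishing almost everywhere on each coset would not be enough, because
  an uncountable union of null sets need not be null.
\<close>

lemma sigma_compact_support:
  assumes lc: "locally_compact_space (euclidean :: 'a topology)"
    and F: "F \<in> Y" "continuous_on UNIV F"
  obtains K :: "nat \<Rightarrow> 'a set" where "\<And>n. compact (K n)" "{z. F z \<noteq> 0} \<subseteq> (\<Union>n. K n)"
proof -
  obtain \<C> :: "'a set set" where \<C>: "\<Union>\<C> = UNIV" "disjoint \<C>" "\<And>C. C \<in> \<C> \<Longrightarrow> open C"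
    "\<And>C. C \<in> \<C> \<Longrightarrow> \<exists>P :: nat \<Rightarrow> 'a set. (\<forall>n. compact (P n)) \<and> C = (\<Union>n. P n)"
    using partition_into_sigma_compact_open[OF lc] by blast
  define \<C>\<^sub>0 where "\<C>\<^sub>0 = {C \<in> \<C>. nY (\<lambda>z. indicator C z * F z) \<noteq> 0}"
  have count: "countable \<C>\<^sub>0"
    unfolding \<C>\<^sub>0_def using \<C>(3) by (intro countably_many_pieces F \<C>(2)) auto
  obtain P where P: "\<And>C. C \<in> \<C> \<Longrightarrow> (\<forall>n::nat. compact (P C n)) \<and> C = (\<Union>n. P C n)"
    using \<C>(4) by metis
  \<comment> \<open>The empty set is added so that the family can be enumerated even if no coset is left.\<close>
  define \<K> where "\<K> = insert {} ((\<lambda>(C, n). P C n) ` (\<C>\<^sub>0 \<times> (UNIV :: nat set)))"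
  have "countable \<K>" "\<K> \<noteq> {}" unfolding \<K>_def using count by auto
  then obtain K :: "nat \<Rightarrow> 'a set" where K: "range K = \<K>" by (metis uncountable_def)
  show ?thesis
  proof (rule that[of K])
    have "compact k" if "k \<in> \<K>" for k
      using that P unfolding \<K>_def \<C>\<^sub>0_def by auto
    then show "compact (K n)" for n using K by blast
    show "{z. F z \<noteq> 0} \<subseteq> (\<Union>n. K n)"
    proof
      fix z assume z: "z \<in> {z. F z \<noteq> 0}"
      obtain C where C: "C \<in> \<C>" "z \<in> C" by (metis UNIV_I UnionE \<C>(1))
      have "nY (\<lambda>z. indicator C z * F z) \<noteq> 0"
      proof
        assume 0: "nY (\<lambda>z. indicator C z * F z) = 0"
        have "(\<lambda>z. indicator C z * F z) \<in> Y" using \<C>(3)[OF C(1)] by (intro Y_restrict F) simp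
        then have "AE z in M. indicator C z * F z = 0" using 0 nY_eq_0_iff by blast
        then have "AE z in M. z \<notin> C \<inter> {z. F z \<noteq> 0}"
          by eventually_elim (auto simp: indicator_def)
        moreover have op: "open (C \<inter> {z. F z \<noteq> 0})"
          using \<C>(3)[OF C(1)] F(2) by (intro open_Int open_Collect_neq continuous_intros) auto
        ultimately have "emeasure M (C \<inter> {z. F z \<noteq> 0}) = 0"
          by (intro AE_iff_measurable[THEN iffD1]) auto
        then have "C \<inter> {z. F z \<noteq> 0} = {}" by (rule open_null_empty[OF op])
        then show False using z C by blast
      qed
      then have "C \<in> \<C>\<^sub>0" using C by (simp add: \<C>\<^sub>0_def)
      moreover obtain n where "z \<in> P C n" using P[OF C(1)] C(2) by blast
      ultimately have "z \<in> \<Union>\<K>" unfolding \<K>_def by auto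
      then show "z \<in> (\<Union>n. K n)" using K by simp
    qed
  qed
qed

text \<open>
  The compact sets \<open>U n\<close> need not exhaust the group, so the complements \<open>- U n\<close> need not tend to the
  empty set; the sets that do are their intersections with the \<open>\<sigma>\<close>-compact support.
\<close>

lemma small_outside_compact:
  assumes lc: "locally_compact_space (euclidean :: 'a topology)"
    and F: "F \<in> Y" "continuous_on UNIV F" and e: "0 < e"
  shows "\<exists>U. compact U \<and> nY (\<lambda>z. indicator (- U) z * F z) < e"
proof -
  obtain K :: "nat \<Rightarrow> 'a set" where K: "\<And>n. compact (K n)" "{z. F z \<noteq> 0} \<subseteq> (\<Union>n. K n)"
    using sigma_compact_support[OF lc F] by blast
  define U where "U n = (\<Union>i\<le>n. K i)" for n
  have U: "compact (U n)" for n unfolding U_def using K(1) by (intro compact_UN) auto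
  have KU: "K m \<subseteq> U n" if "m \<le> n" for m n using that by (auto simp: U_def)
  have [measurable]: "K n \<in> sets M" "U n \<in> sets M" for n
    using compact_imp_closed[OF K(1)] compact_imp_closed[OF U] by auto
  have "(\<lambda>n. nY (\<lambda>z. indicator ((\<Union>i. K i) - U n) z * F z)) \<longlonglongrightarrow> 0"
  proof (rule vanishing_restrictions[OF F(1)])
    show "(\<Union>i. K i) - U n \<in> sets M" for n by measurable
    show "\<forall>\<^sub>F n in sequentially. z \<notin> (\<Union>i. K i) - U n" for z
    proof (cases "\<exists>m. z \<in> K m")
      case True
      then obtain m where "z \<in> K m" by blast
      then show ?thesis using KU by (auto simp: eventually_sequentially intro!: exI[of _ m])
    qed simp
  qed
  moreover have "(\<lambda>z. indicator ((\<Union>i. K i) - U n) z * F z) = (\<lambda>z. indicator (- U n) z * F z)" for n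
  proof
    fix z show "indicator ((\<Union>i. K i) - U n) z * F z = indicator (- U n) z * F z"
      using K(2) by (cases "F z = 0") (auto simp: indicator_def)
  qed
  ultimately have "(\<lambda>n. nY (\<lambda>z. indicator (- U n) z * F z)) \<longlonglongrightarrow> 0" by simp
  then have "\<forall>\<^sub>F n in sequentially. nY (\<lambda>z. indicator (- U n) z * F z) < e"
    by (rule order_tendstoD(2)[OF _ e])
  then show ?thesis using U by (auto simp: eventually_sequentially)
qed

end

section \<open>Compactness in the coorbit space\<close>

locale coorbit = test_functions M \<nu> \<pi> g0 + absolutely_continuous_space M Y nY
  for M :: "'g::{topological_group_add,t2_space} measure" and \<nu>
    and \<pi> :: "'g \<Rightarrow> 'h::complex_hilbert_space \<Rightarrow> 'h" and g0 Y nY +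
  fixes g :: 'h
  assumes ti: "translation_invariant Y"
    and g: "g \<in> \<A>" and emb: "coorbit_embedding M \<nu> \<pi> g0 Y nY g"
begin

abbreviation "X \<equiv> coorbit_space M \<nu> \<pi> g0 Y g"
abbreviation "dX \<equiv> coorbit_dist M \<nu> \<pi> g0 Y nY g"
abbreviation "V \<equiv> voice_transform \<pi> g"

sublocale co: Metric_space X dX
  by (rule coorbit_Metric_space[OF bfs emb weight])

lemma coorbit_D: "f \<in> X \<Longrightarrow> f \<in> \<D>" and coorbit_Y: "f \<in> X \<Longrightarrow> V f \<in> Y"
  by (auto simp: coorbit_space_def)

lemma coorbit_diff: "f1 \<in> X \<Longrightarrow> f2 \<in> X \<Longrightarrow> (\<lambda>h. f1 h - f2 h) \<in> X"
  using distribution_diff[OF coorbit_D coorbit_D] Y_diff[OF coorbit_Y coorbit_Y]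
  by (auto simp: coorbit_space_def voice_transform_diff)

lemma coorbit_dist_eq: "f1 \<in> X \<Longrightarrow> f2 \<in> X \<Longrightarrow> dX f1 f2 = nY (\<lambda>z. V f1 z - V f2 z)"
  by (simp add: coorbit_dist_def coorbit_norm_def voice_transform_diff)

lemma embedding_bound:
  obtains C where "0 \<le> C" "\<And>f. f \<in> X \<Longrightarrow> \<D>_norm f \<le> C * nY (V f)"
proof -
  obtain C where C: "\<And>f. f \<in> X \<Longrightarrow> \<D>_norm f \<le> C * nY (V f)"
    using emb unfolding coorbit_embedding_def coorbit_norm_def by blast
  have "\<D>_norm f \<le> \<bar>C\<bar> * nY (V f)" if "f \<in> X" for f
    using C[OF that] mult_right_mono[OF abs_ge_self[of C] nY_nonneg[OF coorbit_Y[OF that]]] by linarith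
  then show ?thesis using that[of "\<bar>C\<bar>"] by simp
qed

text \<open>
  Evaluation at a test function is Lipschitz for the coorbit metric.
\<close>

lemma evaluation_bound:
  obtains C where "0 \<le> C" "\<And>f1 f2 h. f1 \<in> X \<Longrightarrow> f2 \<in> X \<Longrightarrow> h \<in> \<A> \<Longrightarrow> cmod (f1 h - f2 h) \<le> C * dX f1 f2 * \<A>_norm h"
proof -
  obtain C where C: "0 \<le> C" "\<And>f. f \<in> X \<Longrightarrow> \<D>_norm f \<le> C * nY (V f)" using embedding_bound by blast
  have "cmod (f1 h - f2 h) \<le> C * dX f1 f2 * \<A>_norm h" if f: "f1 \<in> X" "f2 \<in> X" and h: "h \<in> \<A>" for f1 f2 h
  proof -
    have "cmod (f1 h - f2 h) \<le> \<D>_norm (\<lambda>h. f1 h - f2 h) * \<A>_norm h"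
      using distribution_bound[OF coorbit_D[OF coorbit_diff[OF f]] h] .
    also have "\<dots> \<le> C * dX f1 f2 * \<A>_norm h"
      using C(2)[OF coorbit_diff[OF f]] f
      by (intro mult_right_mono test_norm_nonneg) (simp add: coorbit_dist_eq voice_transform_diff)
    finally show ?thesis .
  qed
  then show ?thesis using that C(1) by blast
qed

lemma pointwise_limit_distribution:
  assumes \<sigma>: "\<And>n. \<sigma> n \<in> \<D>" and lim: "\<And>h. (\<lambda>n. \<sigma> n h) \<longlonglongrightarrow> f h"
    and B: "\<And>n h. h \<in> \<A> \<Longrightarrow> cmod (\<sigma> n h) \<le> B * \<A>_norm h"
  shows "f \<in> \<D>"
proof -
  have "f h = 0" if "h \<notin> \<A>" for h
  proof -
    have "(\<lambda>n. \<sigma> n h) = (\<lambda>n. 0)" using \<sigma> that by (auto simp: distribution_space_def)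
    then show ?thesis using LIMSEQ_unique[OF lim[of h]] by simp
  qed
  moreover have "f (h + k) = f h + f k" if "h \<in> \<A>" "k \<in> \<A>" for h k
  proof -
    have "(\<lambda>n. \<sigma> n (h + k)) = (\<lambda>n. \<sigma> n h + \<sigma> n k)" using \<sigma> that by (auto simp: distribution_space_def)
    then have "(\<lambda>n. \<sigma> n h + \<sigma> n k) \<longlonglongrightarrow> f (h + k)" using lim[of "h + k"] by simp
    then show ?thesis using tendsto_add[OF lim[of h] lim[of k]] LIMSEQ_unique by blast
  qed
  moreover have "f (c *\<^sub>C h) = cnj c * f h" if "h \<in> \<A>" for c h
  proof -
    have "(\<lambda>n. \<sigma> n (c *\<^sub>C h)) = (\<lambda>n. cnj c * \<sigma> n h)" using \<sigma> that by (auto simp: distribution_space_def)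
    then have "(\<lambda>n. cnj c * \<sigma> n h) \<longlonglongrightarrow> f (c *\<^sub>C h)" using lim[of "c *\<^sub>C h"] by simp
    then show ?thesis using tendsto_mult_left[OF lim[of h], of "cnj c"] LIMSEQ_unique by blast
  qed
  moreover have "cmod (f h) \<le> B * \<A>_norm h" if "h \<in> \<A>" for h
    using B[OF that] by (intro LIMSEQ_le_const2[OF tendsto_norm[OF lim]]) auto
  ultimately show ?thesis unfolding distribution_space_def by blast
qed

text \<open>
  The pointwise limit \<open>f\<close> is a distribution by the bound on evaluations, and its voice transform is
  the norm limit of those of the sequence.
\<close>

lemma coorbit_complete: "co.mcomplete"
  unfolding co.mcomplete_def
proof (intro allI impI)
  fix \<sigma> assume C: "co.MCauchy \<sigma>"
  then have \<sigma>: "\<sigma> n \<in> X" for n by (auto simp: co.MCauchy_def)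
  have Cau: "\<exists>N. \<forall>m\<ge>N. \<forall>n\<ge>N. dX (\<sigma> m) (\<sigma> n) < e" if "0 < e" for e
    using C that unfolding co.MCauchy_def by meson
  obtain K where K: "0 \<le> K"
    "\<And>f1 f2 h. f1 \<in> X \<Longrightarrow> f2 \<in> X \<Longrightarrow> h \<in> \<A> \<Longrightarrow> cmod (f1 h - f2 h) \<le> K * dX f1 f2 * \<A>_norm h"
    using evaluation_bound by blast
  have "\<exists>l. (\<lambda>n. \<sigma> n h) \<longlonglongrightarrow> l" for h
  proof (cases "h \<in> \<A>")
    case False
    then have "\<sigma> n h = 0" for n using coorbit_D[OF \<sigma>, of n] by (auto simp: distribution_space_def)
    then show ?thesis by (auto intro: exI[of _ 0])
  next
    case True
    have "Cauchy (\<lambda>n. \<sigma> n h)"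
    proof (rule metric_CauchyI)
      fix e :: real assume e: "0 < e"
      let ?c = "K * \<A>_norm h + 1"
      have c: "0 < ?c" using K(1) test_norm_nonneg[of h] by (simp add: add_nonneg_pos)
      obtain N where N: "\<forall>m\<ge>N. \<forall>n\<ge>N. dX (\<sigma> m) (\<sigma> n) < e / ?c" using Cau[of "e / ?c"] e c by auto
      have "dist (\<sigma> m h) (\<sigma> n h) < e" if "N \<le> m" "N \<le> n" for m n
      proof -
        have "cmod (\<sigma> m h - \<sigma> n h) \<le> K * \<A>_norm h * dX (\<sigma> m) (\<sigma> n)"
          using K(2)[OF \<sigma> \<sigma> True, of m n] by (simp add: ac_simps)
        also have "\<dots> \<le> ?c * dX (\<sigma> m) (\<sigma> n)" by (intro mult_right_mono) auto
        also have "\<dots> < ?c * (e / ?c)" using N that c by (intro mult_strict_left_mono) auto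
        also have "\<dots> = e" using c by simp
        finally show ?thesis by (simp add: dist_norm)
      qed
      then show "\<exists>N. \<forall>m\<ge>N. \<forall>n\<ge>N. dist (\<sigma> m h) (\<sigma> n h) < e" by blast
    qed
    then show ?thesis by (simp add: Cauchy_convergent_iff convergent_def)
  qed
  then obtain f where f: "\<And>h. (\<lambda>n. \<sigma> n h) \<longlonglongrightarrow> f h" by metis
  obtain N where N: "\<forall>m\<ge>N. \<forall>n\<ge>N. dX (\<sigma> m) (\<sigma> n) < 1" using Cau[of 1] by auto
  have fD: "f \<in> \<D>"
  proof (rule pointwise_limit_distribution[of "\<lambda>n. \<sigma> (n + N)"])
    show "\<sigma> (n + N) \<in> \<D>" for n by (rule coorbit_D[OF \<sigma>])
    show "(\<lambda>n. \<sigma> (n + N) h) \<longlonglongrightarrow> f h" for h by (rule LIMSEQ_ignore_initial_segment[OF f])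
    show "cmod (\<sigma> (n + N) h) \<le> (K + \<D>_norm (\<sigma> N)) * \<A>_norm h" if h: "h \<in> \<A>" for n h
    proof -
      have "cmod (\<sigma> (n + N) h) \<le> cmod (\<sigma> (n + N) h - \<sigma> N h) + cmod (\<sigma> N h)"
        using norm_triangle_sub[of "\<sigma> (n + N) h" "\<sigma> N h"] by simp
      also have "\<dots> \<le> K * dX (\<sigma> (n + N)) (\<sigma> N) * \<A>_norm h + \<D>_norm (\<sigma> N) * \<A>_norm h"
        by (intro add_mono K(2) \<sigma> h distribution_bound coorbit_D)
      also have "\<dots> \<le> K * 1 * \<A>_norm h + \<D>_norm (\<sigma> N) * \<A>_norm h"
        using N K(1) by (intro add_right_mono mult_right_mono mult_left_mono test_norm_nonneg) (auto intro: less_imp_le)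
      finally show ?thesis by (simp add: distrib_right)
    qed
  qed
  have "\<exists>N. \<forall>m\<ge>N. \<forall>n\<ge>N. nY (\<lambda>z. V (\<sigma> m) z - V (\<sigma> n) z) < e" if "0 < e" for e
    using Cau[OF that] \<sigma> by (simp add: coorbit_dist_eq)
  then obtain H where H: "H \<in> Y" "(\<lambda>n. nY (\<lambda>z. V (\<sigma> n) z - H z)) \<longlonglongrightarrow> 0"
    using Y_complete[of "\<lambda>n. V (\<sigma> n)"] coorbit_Y[OF \<sigma>] by blast
  have ptw: "(\<lambda>n. V (\<sigma> n) z) \<longlonglongrightarrow> V f z" for z unfolding voice_transform_def by (rule f)
  note lim = pointwise_limit_in_Y[OF coorbit_Y[OF \<sigma>] H ptw]
  have fX: "f \<in> X" using fD lim(1) by (simp add: coorbit_space_def)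
  have "(\<lambda>n. dX (\<sigma> n) f) \<longlonglongrightarrow> 0" using lim(2) \<sigma> fX by (simp add: coorbit_dist_eq)
  then show "\<exists>x. limitin co.mtopology \<sigma> x sequentially"
    unfolding co.limitin_metric_dist_null using fX \<sigma> by auto
qed

lemma net_on_compact:
  assumes S: "S \<subseteq> X" and B: "\<And>f. f \<in> S \<Longrightarrow> nY (V f) \<le> B" and U: "compact U" and e: "0 < e"
  shows "\<exists>T\<subseteq>S. finite T \<and> (\<forall>f\<in>S. \<exists>t\<in>T. \<forall>z\<in>U. cmod (V f z - V t z) < e)"
proof (rule equicontinuous_finite_net[OF U _ _ e])
  obtain C where C: "0 \<le> C" "\<And>f. f \<in> X \<Longrightarrow> \<D>_norm f \<le> C * nY (V f)" using embedding_bound by blast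
  have DB: "S \<subseteq> {f \<in> \<D>. \<D>_norm f \<le> C * B}"
    using S coorbit_D order_trans[OF C(2) mult_left_mono[OF B C(1)]] by blast
  show "bounded ((\<lambda>f. V f z) ` S)" for z
  proof (rule boundedI)
    fix y assume "y \<in> (\<lambda>f. V f z) ` S"
    then obtain f where f: "f \<in> S" "y = V f z" by blast
    then have "f \<in> \<D>" "\<D>_norm f \<le> C * B" using DB by auto
    then show "norm y \<le> C * B * \<A>_norm (\<pi> z g)"
      using order_trans[OF voice_transform_bound[OF _ g] mult_right_mono[OF _ test_norm_nonneg]] f(2) by simp
  qed
  show "\<exists>W. open W \<and> z \<in> W \<and> (\<forall>w\<in>W. \<forall>f\<in>S. cmod (V f w - V f z) < e)" if "0 < e" for z e
    using voice_transform_equicontinuous[OF g that, of z "C * B"] DB by blast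
qed

text \<open>
  If some \<open>V f\<close> is nonzero, then the norm of the indicator of \<open>U\<close> serves as the constant.
  Otherwise the left-hand side is always \<open>0\<close>; this case occurs for instance if \<open>Y\<close> has only null
  functions, when that indicator need not lie in \<open>Y\<close>.
\<close>

lemma restriction_constant:
  assumes S: "S \<subseteq> X" and U: "compact U"
  shows "\<exists>c\<ge>0. \<forall>f1\<in>S. \<forall>f2\<in>S. \<forall>\<delta>\<ge>0. (\<forall>z\<in>U. cmod (V f1 z - V f2 z) \<le> \<delta>) \<longrightarrow>
    nY (\<lambda>z. indicator U z * (V f1 z - V f2 z)) \<le> \<delta> * c"
proof (cases "\<exists>f\<in>S. \<exists>a. V f a \<noteq> 0")
  case True
  then obtain f a where f: "f \<in> S" "V f a \<noteq> 0" by blast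
  have fX: "f \<in> X" using S f by blast
  have UY: "(\<lambda>z. indicator U z) \<in> Y"
    by (rule indicator_compact_in_Y[OF ti coorbit_Y[OF fX] continuous_voice_transform[OF coorbit_D[OF fX] g] f(2) U])
  show ?thesis
  proof (intro exI[of _ "nY (indicator U)"] conjI ballI allI impI)
    show "0 \<le> nY (indicator U)" using nY_nonneg[OF UY] by simp
    fix f1 f2 and \<delta> :: real assume "f1 \<in> S" "f2 \<in> S" "0 \<le> \<delta>" "\<forall>z\<in>U. cmod (V f1 z - V f2 z) \<le> \<delta>"
    then show "nY (\<lambda>z. indicator U z * (V f1 z - V f2 z)) \<le> \<delta> * nY (indicator U)"
      using S by (intro nY_restrict_le_sup U UY Y_diff coorbit_Y) auto
  qed
next
  case False
  have "nY (\<lambda>z. 0) = 0" using nY_eq_0_iff[OF Y_zero] by simp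
  then show ?thesis using False by (intro exI[of _ 0]) simp
qed

text \<open>
  A net that is fine on \<open>U\<close> in the uniform norm is a net in the coorbit space, since the parts
  outside \<open>U\<close> contribute at most twice the size of the tails.
\<close>

lemma uniformly_small_tails_totally_bounded:
  assumes S: "S \<subseteq> X" and B: "\<And>f. f \<in> S \<Longrightarrow> nY (V f) \<le> B"
    and tails: "\<And>e. 0 < e \<Longrightarrow> \<exists>U. compact U \<and> (\<forall>f\<in>S. nY (\<lambda>z. indicator (- U) z * V f z) < e)"
  shows "co.mtotally_bounded S"
  unfolding co.mtotally_bounded_def
proof (intro allI impI)
  fix e :: real assume e: "0 < e"
  obtain U where U: "compact U" "\<And>f. f \<in> S \<Longrightarrow> nY (\<lambda>z. indicator (- U) z * V f z) < e/4"
    using tails[of "e/4"] e by auto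
  have Um: "U \<in> sets M" "- U \<in> sets M" using compact_imp_closed[OF U(1)] by auto
  obtain c where c: "0 \<le> c" "\<And>f1 f2 \<delta>. f1 \<in> S \<Longrightarrow> f2 \<in> S \<Longrightarrow> 0 \<le> \<delta> \<Longrightarrow>
      (\<forall>z\<in>U. cmod (V f1 z - V f2 z) \<le> \<delta>) \<Longrightarrow> nY (\<lambda>z. indicator U z * (V f1 z - V f2 z)) \<le> \<delta> * c"
    using restriction_constant[OF S U(1)] by blast
  define \<delta> where "\<delta> = e / (4 * (c + 1))"
  have \<delta>: "0 < \<delta>" using e c(1) by (simp add: \<delta>_def)
  have \<delta>c: "\<delta> * c \<le> e/4"
  proof -
    have "\<delta> * c = e/4 * (c / (c + 1))" using c(1) by (simp add: \<delta>_def divide_simps)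
    also have "\<dots> \<le> e/4" using c(1) e by (intro mult_left_le) auto
    finally show ?thesis .
  qed
  obtain T where T: "T \<subseteq> S" "finite T" "\<And>f. f \<in> S \<Longrightarrow> \<exists>t\<in>T. \<forall>z\<in>U. cmod (V f z - V t z) < \<delta>"
    using net_on_compact[OF S B U(1) \<delta>] by blast
  have "S \<subseteq> (\<Union>t\<in>T. co.mball t e)"
  proof
    fix f assume f: "f \<in> S"
    obtain t where t: "t \<in> T" "\<And>z. z \<in> U \<Longrightarrow> cmod (V f z - V t z) < \<delta>" using T(3)[OF f] by blast
    have tS: "t \<in> S" using t(1) T(1) by blast
    have X: "f \<in> X" "t \<in> X" using f tS S by auto
    note Y = coorbit_Y[OF X(1)] coorbit_Y[OF X(2)]
    note R = Y_restrict(1)[OF Y(1) Um(2)] Y_restrict(1)[OF Y(2) Um(2)]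
    have "dX f t = nY (\<lambda>z. indicator U z * (V f z - V t z) + (indicator (- U) z * V f z - indicator (- U) z * V t z))"
      unfolding coorbit_dist_eq[OF X] by (intro arg_cong[of _ _ nY] ext) (auto simp: indicator_def)
    also have "\<dots> \<le> nY (\<lambda>z. indicator U z * (V f z - V t z)) + nY (\<lambda>z. indicator (- U) z * V f z - indicator (- U) z * V t z)"
      by (intro nY_triangle Y_restrict Y_diff Y R Um)
    also have "\<dots> \<le> \<delta> * c + (e/4 + e/4)"
    proof (intro add_mono)
      show "nY (\<lambda>z. indicator U z * (V f z - V t z)) \<le> \<delta> * c"
        using t(2) \<delta> by (intro c(2) f tS) (auto intro: less_imp_le)
      have "nY (\<lambda>z. indicator (- U) z * V f z - indicator (- U) z * V t z)
          \<le> nY (\<lambda>z. indicator (- U) z * V f z) + nY (\<lambda>z. indicator (- U) z * V t z)"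
        by (rule nY_triangle_diff[OF R])
      then show "nY (\<lambda>z. indicator (- U) z * V f z - indicator (- U) z * V t z) \<le> e/4 + e/4"
        using U(2)[OF f] U(2)[OF tS] by linarith
    qed
    also have "\<dots> < e" using \<delta>c e by linarith
    finally have "f \<in> co.mball t e" using X by (simp add: co.commute)
    then show "f \<in> (\<Union>t\<in>T. co.mball t e)" using t(1) by blast
  qed
  then show "\<exists>K. finite K \<and> K \<subseteq> S \<and> S \<subseteq> (\<Union>x\<in>K. co.mball x e)" using T(1,2) by blast
qed

text \<open>
  The union of the compact sets belonging to the members of a finite net serves for all of \<open>S\<close>.
\<close>

lemma totally_bounded_uniformly_small_tails:
  assumes S: "co.mtotally_bounded S" and e: "0 < e"
  shows "\<exists>U. compact U \<and> (\<forall>f\<in>S. nY (\<lambda>z. indicator (- U) z * V f z) \<le> e)"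
proof -
  obtain T where T: "finite T" "T \<subseteq> S" "S \<subseteq> (\<Union>t\<in>T. co.mball t (e/2))"
    using S e unfolding co.mtotally_bounded_def by (meson half_gt_zero)
  have SX: "S \<subseteq> X" using S by (rule co.mtotally_bounded_imp_subset)
  have "\<forall>t\<in>T. \<exists>U. compact U \<and> nY (\<lambda>z. indicator (- U) z * V t z) < e/2"
  proof
    fix t assume "t \<in> T"
    then have t: "t \<in> X" using T(2) SX by blast
    show "\<exists>U. compact U \<and> nY (\<lambda>z. indicator (- U) z * V t z) < e/2"
      using e by (intro small_outside_compact lc coorbit_Y t continuous_voice_transform coorbit_D g) simp
  qed
  then obtain U where U: "\<And>t. t \<in> T \<Longrightarrow> compact (U t)" "\<And>t. t \<in> T \<Longrightarrow> nY (\<lambda>z. indicator (- U t) z * V t z) < e/2"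
    by metis
  let ?U = "\<Union>t\<in>T. U t"
  have cU: "compact ?U" using T(1) U(1) by (intro compact_UN)
  have m: "- ?U \<in> sets M"
    unfolding sets_M by (intro borel_comp borel_closed compact_imp_closed cU)
  have "nY (\<lambda>z. indicator (- ?U) z * V f z) \<le> e" if f: "f \<in> S" for f
  proof -
    obtain t where t: "t \<in> T" "dX t f < e/2" using T(3) f by auto
    have X: "f \<in> X" "t \<in> X" using f t T(2) SX by auto
    note Y = coorbit_Y[OF X(1)] coorbit_Y[OF X(2)]
    have mt: "- U t \<in> sets M" using compact_imp_closed[OF U(1)[OF t(1)]] by auto
    have "nY (\<lambda>z. indicator (- ?U) z * V f z)
        = nY (\<lambda>z. indicator (- ?U) z * (V f z - V t z) + indicator (- ?U) z * V t z)"
      by (simp add: algebra_simps)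
    also have "\<dots> \<le> nY (\<lambda>z. indicator (- ?U) z * (V f z - V t z)) + nY (\<lambda>z. indicator (- ?U) z * V t z)"
      by (intro nY_triangle Y_restrict Y_diff Y m)
    also have "\<dots> \<le> nY (\<lambda>z. V f z - V t z) + nY (\<lambda>z. indicator (- U t) z * V t z)"
      using t(1) by (intro add_mono Y_restrict(2) Y_diff Y m mt nY_restrict_mono) auto
    also have "\<dots> \<le> e/2 + e/2"
      using t(2) U(2)[OF t(1)] coorbit_dist_eq[OF X] co.commute[of t f] by (intro add_mono) auto
    finally show ?thesis by simp
  qed
  then show ?thesis using cU by blast
qed

theorem compact_iff_uniformly_small_tails:
  assumes closed: "closedin (coorbit_topology M \<nu> \<pi> g0 Y nY g) S"
    and bdd: "\<exists>B. \<forall>f\<in>S. coorbit_norm \<pi> nY g f \<le> B"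
  shows "compactin (coorbit_topology M \<nu> \<pi> g0 Y nY g) S \<longleftrightarrow>
    (\<forall>\<epsilon>::real. 0 < \<epsilon> \<longrightarrow> (\<exists>U::'g set. compact U \<and>
        (SUP f\<in>S. ennreal (nY (\<lambda>z. indicator (- U) z * voice_transform \<pi> g f z))) < ennreal \<epsilon>))"
proof -
  have top: "coorbit_topology M \<nu> \<pi> g0 Y nY g = co.mtopology" by (simp add: coorbit_topology_def)
  have closed': "closedin co.mtopology S" using closed by (simp add: top)
  then have SX: "S \<subseteq> X" using closedin_subset by fastforce
  have compact_iff: "compactin co.mtopology S \<longleftrightarrow> co.mtotally_bounded S"
    using co.mtotally_bounded_eq_compact_closure_of[OF coorbit_complete, of S] SX
    by (simp add: closure_of_closedin[OF closed'])
  show ?thesis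
    unfolding top compact_iff
  proof (intro iffI allI impI)
    fix \<epsilon> :: real assume "co.mtotally_bounded S" "0 < \<epsilon>"
    then obtain U where U: "compact U" "\<forall>f\<in>S. nY (\<lambda>z. indicator (- U) z * V f z) \<le> \<epsilon>/2"
      using totally_bounded_uniformly_small_tails[of S "\<epsilon>/2"] by auto
    have "(SUP f\<in>S. ennreal (nY (\<lambda>z. indicator (- U) z * V f z))) \<le> ennreal (\<epsilon>/2)"
      using U(2) by (intro SUP_least ennreal_leI) auto
    also have "\<dots> < ennreal \<epsilon>" using \<open>0 < \<epsilon>\<close> by (simp add: ennreal_less_iff)
    finally show "\<exists>U. compact U \<and> (SUP f\<in>S. ennreal (nY (\<lambda>z. indicator (- U) z * V f z))) < ennreal \<epsilon>"
      using U(1) by blast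
  next
    assume tails: "\<forall>\<epsilon>::real. 0 < \<epsilon> \<longrightarrow> (\<exists>U. compact U \<and>
      (SUP f\<in>S. ennreal (nY (\<lambda>z. indicator (- U) z * V f z))) < ennreal \<epsilon>)"
    obtain B where B: "\<And>f. f \<in> S \<Longrightarrow> nY (V f) \<le> B" using bdd by (auto simp: coorbit_norm_def)
    show "co.mtotally_bounded S"
    proof (rule uniformly_small_tails_totally_bounded[OF SX B])
      fix e :: real assume e: "0 < e"
      then obtain U where U: "compact U" "(SUP f\<in>S. ennreal (nY (\<lambda>z. indicator (- U) z * V f z))) < ennreal e"
        using tails by blast
      have "nY (\<lambda>z. indicator (- U) z * V f z) < e" if f: "f \<in> S" for f
      proof -
        have "f \<in> X" using f SX by blast
        then have "0 \<le> nY (\<lambda>z. indicator (- U) z * V f z)"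
          using compact_imp_closed[OF U(1)] by (intro nY_nonneg Y_restrict coorbit_Y) auto
        moreover have "ennreal (nY (\<lambda>z. indicator (- U) z * V f z)) < ennreal e"
          using le_less_trans[OF SUP_upper[OF f] U(2)] .
        ultimately show ?thesis by (simp add: ennreal_less_iff)
      qed
      then show "\<exists>U. compact U \<and> (\<forall>f\<in>S. nY (\<lambda>z. indicator (- U) z * V f z) < e)" using U(1) by blast
    qed
  qed
qed

end

theorem theorem4:
  fixes M :: "'g::{topological_group_add,t2_space} measure"
    and \<nu> :: "'g \<Rightarrow> real"
    and \<pi> :: "'g \<Rightarrow> 'h::complex_hilbert_space \<Rightarrow> 'h"
    and Y :: "('g \<Rightarrow> complex) set"
    and nY :: "('g \<Rightarrow> complex) \<Rightarrow> real"
    and g0 g :: 'h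
    and S :: "('h \<Rightarrow> complex) set"
  assumes "locally_compact_space (euclidean :: 'g topology)"
    and "left_haar_measure M"
    and "submultiplicative_weight \<nu>"
    and "unitary_representation \<pi>"
    and "strongly_continuous \<pi>"
    and "irreducible_representation \<pi>"
    and "integrable_representation M \<nu> \<pi>"
    and "banach_function_space M Y nY"
    and "solid M Y nY"
    and "translation_invariant Y"
    and "convolution_module M \<nu> Y nY"
    and "absolutely_continuous_norm M Y nY"
    and "g0 \<noteq> 0"
    and "integrable_vector M \<nu> \<pi> g0"
    and "g \<in> test_space M \<nu> \<pi> g0"
    and "g \<noteq> 0"
    and "coorbit_embedding M \<nu> \<pi> g0 Y nY g"
    and "closedin (coorbit_topology M \<nu> \<pi> g0 Y nY g) S"
    and "\<exists>B. \<forall>f\<in>S. coorbit_norm \<pi> nY g f \<le> B"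
  shows "compactin (coorbit_topology M \<nu> \<pi> g0 Y nY g) S \<longleftrightarrow>
    (\<forall>\<epsilon>::real. 0 < \<epsilon> \<longrightarrow>
      (\<exists>U::'g set. compact U \<and>
        (SUP f\<in>S. ennreal (nY (\<lambda>z. indicator (- U) z * voice_transform \<pi> g f z)))
          < ennreal \<epsilon>))"
proof -
  interpret coorbit M \<nu> \<pi> g0 Y nY g
    by unfold_locales (fact assms)+
  show ?thesis by (rule compact_iff_uniformly_small_tails) (fact assms)+
qed

end
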